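(* An elementary program for computing the product $A_{22}B_{22}$ of two $2\times 2$ matrices has a length $R_{222}\le 7$ if and only if its defining triple $\{U,V,W\}$ is equivalent to the triple defining Strassen's algorithm of 1969.
   Context: All matrix subscripts range over $\{0,1\}$. **Elementary program.** A triple $U=(u_{ij}^{(s)})$, $V=(v_{gh}^{(s)})$, $W=(w_{lq}^{(s)})$, $s=1,\dots,R$, of arrays of numbers defines an elementary program of length $R=R_{222}$ for multiplying $A_{22}=(a_{ij})$ by $B_{22}=(b_{gh})$ if, identically in the $a_{ij},b_{gh}$, $$c_{lq}=\sum_{g=0}^{1}a_{lg}b_{gq}\equiv\sum_{s=1}^{R}w_{lq}^{(s)}\Big(\sum_{i=0}^{1}\sum_{j=0}^{1}u_{ij}^{(s)}a_{ij}\Big)\Big(\sum_{g=0}^{1}\sum_{h=0}^{1}v_{gh}^{(s)}b_{gh}\Big)\qquad (l,q\in\{0,1\}).$$ **Equivalence.** Two triples $\{U,V,W\}$ and $\{\overline U,\overline V,\overline W\}$, each defining an elementary program of length $R$, are said to be equivalent to one another if, for all $s=1,\dots,R$ and all subscripts, $$\overline u_{ij}^{(s)}=\sum_{\nu,\kappa}\sigma_{i\nu}\nabla_{j\kappa}u_{\nu\kappa}^{(t(s))},\qquad \overline v_{gh}^{(s)}=\sum_{\nu,\kappa}\lambda_{\nu g}\mu_{h\kappa}v_{\nu\kappa}^{(t(s))},\qquad \overline w_{lq}^{(s)}=\sum_{\nu,\kappa}\gamma_{\nu l}\beta_{\kappa q}w_{\nu\kappa}^{(t(s))},$$ where the $2\times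 2$ matrices in each of the three pairs $(\sigma_{i\nu})$ and $(\gamma_{\nu l})$; $(\nabla_{j\kappa})$ and $(\lambda_{\nu g})$; $(\mu_{h\kappa})$ and $(\beta_{\kappa q})$ are the inverses of one another, and where the $t(s)$ are integers with $1\le t(s)\le R$ and $t(s_1)\ne t(s_2)$ for $s_1\ne s_2$ (that is, $t$ is a permutation of $\{1,\dots,R\}$). **Strassen's algorithm (1969).** With $P_1=(a_{00}+a_{11})(b_{00}+b_{11})$, $P_2=(a_{10}+a_{11})b_{00}$, $P_3=a_{00}(b_{01}-b_{11})$, $P_4=a_{11}(b_{10}-b_{00})$, $P_5=(a_{00}+a_{01})b_{11}$, $P_6=(a_{10}-a_{00})(b_{00}+b_{01})$, $P_7=(a_{01}-a_{11})(b_{10}+b_{11})$, the entries of the product $(c_{lq})=A_{22}B_{22}$ are $c_{00}=P_1+P_4-P_5+P_7$, $c_{01}=P_3+P_5$, $c_{10}=P_2+P_4$, $c_{11}=P_1-P_2+P_3+P_6$. Its defining triple consists of the coefficients $u_{ij}^{(s)}$, $v_{gh}^{(s)}$ of the two factors of $P_s$ as displayed and the coefficients $w_{lq}^{(s)}$ of $P_s$ in $c_{lq}$, $s=1,\dots,7$.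
   Formalization: The defining triple is taken only up to rescaling u, v, w within each summand by constants with product 1 (same summands one by one); read literally the claim fails, e.g. for Strassen's triple with u^(1) doubled and w^(1) halved. Numbers are elements of any field of characteristic 0. *)

theory Defs
  imports "HOL-Analysis.Analysis"
begin

text \<open>
  The index type \<open>2\<close> has exactly the elements \<open>0\<close> and \<open>1\<close>, so matrices of type \<open>'a^2^2\<close> carry
  the subscripts \<open>{0,1}\<close>.  The library's \<^const>\<open>vector\<close> numbers entries starting from \<open>1\<close>
  (with \<open>2 = 0\<close> in this type), hence the explicit constructor below.
\<close>

definition mat2 :: "'a \<Rightarrow> 'a \<Rightarrow> 'a \<Rightarrow> 'a \<Rightarrow> 'a^2^2" where
  "mat2 x00 x01 x10 x11 =
     (\<chi> i j. if i = 0 then (if j = 0 then x00 else x01) else (if j = 0 then x10 else x11))"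

text \<open>Only the values of the three arrays at \<open>s = 1, \<dots>, len\<close> are meaningful.\<close>

record 'a triple =
  len :: nat
  ucoeff :: "nat \<Rightarrow> 'a^2^2"
  vcoeff :: "nat \<Rightarrow> 'a^2^2"
  wcoeff :: "nat \<Rightarrow> 'a^2^2"

definition summand ::
    "'a::field_char_0 triple \<Rightarrow> nat \<Rightarrow> 'a^2^2 \<Rightarrow> 'a^2^2 \<Rightarrow> 2 \<Rightarrow> 2 \<Rightarrow> 'a" where
  "summand T s A B l q =
     wcoeff T s $ l $ q
       * (\<Sum>i\<in>UNIV. \<Sum>j\<in>UNIV. ucoeff T s $ i $ j * A $ i $ j)
       * (\<Sum>g\<in>UNIV. \<Sum>h\<in>UNIV. vcoeff T s $ g $ h * B $ g $ h)"

definition elementary_program :: "'a::field_char_0 triple \<Rightarrow> bool" where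
  "elementary_program T \<longleftrightarrow>
     (\<forall>A B l q. (A ** B) $ l $ q = (\<Sum>s = 1..len T. summand T s A B l q))"

definition inverse_pair :: "'a::field_char_0^2^2 \<Rightarrow> 'a^2^2 \<Rightarrow> bool" where
  "inverse_pair M N \<longleftrightarrow> M ** N = mat 1 \<and> N ** M = mat 1"

text \<open>Here \<open>\<tau>\<close> and \<open>\<Lambda>\<close> are the matrices usually written \<open>\<nabla>\<close> and \<open>\<lambda>\<close>.\<close>

definition equivalent_triples :: "'a::field_char_0 triple \<Rightarrow> 'a triple \<Rightarrow> bool" where
  "equivalent_triples T T' \<longleftrightarrow>
     elementary_program T \<and> elementary_program T' \<and> len T = len T' \<and>
     (\<exists>\<sigma> \<gamma> \<tau> \<Lambda> \<mu> \<beta> t.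
        inverse_pair \<sigma> \<gamma> \<and> inverse_pair \<tau> \<Lambda> \<and> inverse_pair \<mu> \<beta> \<and>
        t ` {1..len T} \<subseteq> {1..len T} \<and> inj_on t {1..len T} \<and>
        (\<forall>s\<in>{1..len T}.
           (\<forall>i j. ucoeff T' s $ i $ j =
              (\<Sum>\<nu>\<in>UNIV. \<Sum>\<kappa>\<in>UNIV. \<sigma> $ i $ \<nu> * \<tau> $ j $ \<kappa> * ucoeff T (t s) $ \<nu> $ \<kappa>)) \<and>
           (\<forall>g h. vcoeff T' s $ g $ h =
              (\<Sum>\<nu>\<in>UNIV. \<Sum>\<kappa>\<in>UNIV. \<Lambda> $ \<nu> $ g * \<mu> $ h $ \<kappa> * vcoeff T (t s) $ \<nu> $ \<kappa>)) \<and>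
           (\<forall>l q. wcoeff T' s $ l $ q =
              (\<Sum>\<nu>\<in>UNIV. \<Sum>\<kappa>\<in>UNIV. \<gamma> $ \<nu> $ l * \<beta> $ \<kappa> $ q * wcoeff T (t s) $ \<nu> $ \<kappa>))))"

text \<open>
  A program determines its triple only up to rescaling the three factors inside each summand
  by constants with product 1, and \<^const>\<open>equivalent_triples\<close> does not absorb such rescalings:
  multiplying the first-factor coefficients of \<open>P\<^sub>1\<close> in Strassen's triple by 2 and the coefficients
  of \<open>P\<^sub>1\<close> in the result by 1/2 gives a triple of length 7 that is not equivalent to Strassen's
  (comparing determinants and then traces of the first-factor matrices).  Therefore a triple
  counts as a defining triple of a given program when it has the same summands
  \<open>w * (\<Sum> u a) * (\<Sum> v b)\<close>, one by one.
\<close>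

definition define_same_program :: "'a::field_char_0 triple \<Rightarrow> 'a triple \<Rightarrow> bool" where
  "define_same_program T T' \<longleftrightarrow>
     len T = len T' \<and>
     (\<forall>s\<in>{1..len T}. \<forall>A B l q. summand T s A B l q = summand T' s A B l q)"

text \<open>
  Row \<open>s\<close> of the first two lists holds the coefficients of the factors of \<open>P\<^sub>s\<close>; row \<open>s\<close> of the
  third holds the coefficients with which \<open>P\<^sub>s\<close> enters \<open>c\<^sub>0\<^sub>0, c\<^sub>0\<^sub>1, c\<^sub>1\<^sub>0, c\<^sub>1\<^sub>1\<close>.
\<close>

definition strassen :: "'a::field_char_0 triple" where
  "strassen = \<lparr>
     len = 7,
     ucoeff = (\<lambda>s. [mat2 1 0 0 1,
                    mat2 0 0 1 1,
                    mat2 1 0 0 0,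
                    mat2 0 0 0 1,
                    mat2 1 1 0 0,
                    mat2 (-1) 0 1 0,
                    mat2 0 1 0 (-1)] ! (s - 1)),
     vcoeff = (\<lambda>s. [mat2 1 0 0 1,
                    mat2 1 0 0 0,
                    mat2 0 1 0 (-1),
                    mat2 (-1) 0 1 0,
                    mat2 0 0 0 1,
                    mat2 1 1 0 0,
                    mat2 0 0 1 1] ! (s - 1)),
     wcoeff = (\<lambda>s. [mat2 1 0 0 1,
                    mat2 0 0 1 (-1),
                    mat2 0 1 0 1,
                    mat2 1 0 1 0,
                    mat2 (-1) 1 0 0,
                    mat2 0 0 0 1,
                    mat2 1 0 0 0] ! (s - 1))\<rparr>"

end

theory Submission
  imports Defs
begin

text \<open>
  The defining identity is read as a decomposition of the trilinear form \<open>trace (A B C)\<close> into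
  seven products of linear forms \<open>u s\<close>, \<open>v s\<close>, \<open>w s\<close> (shorter programs are padded by zero forms).
  Evaluating at a rank one matrix \<open>A\<close> kills every term outside \<open>N = {s. u s A \<noteq> 0}\<close>, and the rest
  decomposes a tensor of rank two.  A dimension count gives \<open>card N \<ge> 2\<close> and \<open>card N \<noteq> 3\<close>; if
  \<open>card N = 2\<close>, the four forms \<open>v s\<close>, \<open>w s\<close> with \<open>s \<in> N\<close> have rank one and their kernels are
  governed by \<open>A\<close>, and if \<open>card N = 4\<close>, a rank one matrix \<open>C\<close> with exactly two nonzero \<open>w s C\<close> can
  be read off.  Hence points with \<open>card N = 2\<close> exist, and each of them forces further ones, until
  there are three for each of \<open>u\<close>, \<open>v\<close>, \<open>w\<close>.  Their nine index pairs are the edges of a complete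
  bipartite graph on 3 + 3 of the seven indices, and the points are determined by three triples
  of lines in the plane, to which the group acting in the definition of equivalence moves those
  of Strassen's program.  The points determine six of the seven terms, and the last one is the
  difference.
\<close>

section \<open>Two by two matrices written out by entries\<close>

lemma UNIV_two: "(UNIV :: 2 set) = {0, 1}"
  using UNIV_2 by auto

lemma sum_two: "(\<Sum>i\<in>(UNIV :: 2 set). f i) = f 0 + f 1"
  by (simp add: UNIV_two)

lemma all_two: "(\<forall>i::2. P i) \<longleftrightarrow> P 0 \<and> P 1"
  by (metis (full_types) UNIV_I UNIV_two empty_iff insert_iff)

lemma vec2_eq_iff: "x = y \<longleftrightarrow> x$0 = y$0 \<and> x$1 = y$1" for x y :: "'a^2"
  by (simp add: vec_eq_iff all_two)

lemma mat2_nth [simp]: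
  "mat2 p q r s $ 0 $ 0 = p" "mat2 p q r s $ 0 $ 1 = q"
  "mat2 p q r s $ 1 $ 0 = r" "mat2 p q r s $ 1 $ 1 = s"
  by (simp_all add: mat2_def)

lemma matrix_mult_two: "(A ** B) $ i $ j = A $ i $ 0 * B $ 0 $ j + A $ i $ 1 * B $ 1 $ j"
  for A B :: "'a::semiring_1^2^2"
  by (simp add: matrix_matrix_mult_def sum_two)

lemma matrix_vector_mult_two: "(A *v x) $ i = A $ i $ 0 * x $ 0 + A $ i $ 1 * x $ 1"
  for A :: "'a::semiring_1^2^2"
  by (simp add: matrix_vector_mult_def sum_two)

lemma trace_two: "trace A = A $ 0 $ 0 + A $ 1 $ 1" for A :: "'a::semiring_1^2^2"
  by (simp add: trace_def sum_two)

lemma transpose_nth: "transpose A $ i $ j = A $ j $ i"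
  by (simp add: transpose_def)

lemma mat_nth: "mat k $ i $ j = (if i = j then k else 0)"
  by (simp add: mat_def)

lemmas two_simps = sum_two vec2_eq_iff matrix_mult_two matrix_vector_mult_two
  transpose_nth mat_nth trace_two

section \<open>The trace of a triple product and its symmetries\<close>

definition pairing :: "'a::field^2^2 \<Rightarrow> 'a^2^2 \<Rightarrow> 'a" where
  "pairing U A = (\<Sum>i\<in>UNIV. \<Sum>j\<in>UNIV. U $ i $ j * A $ i $ j)"

text \<open>
  Row vectors are encoded by column vectors \<open>a\<close> through the symplectic form \<open>bracket\<close>, as
  \<open>y \<mapsto> bracket a y\<close>: the matrix \<open>rank_one x a\<close> maps \<open>y\<close> to \<open>bracket a y *s x\<close>.  Vectors
  orthogonal to \<open>a\<close> are then the multiples of \<open>a\<close>, and cyclic rotation of \<open>A\<close>, \<open>B\<close>, \<open>C\<close> needs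
  no dual spaces.
\<close>

definition bracket :: "'a::field^2 \<Rightarrow> 'a^2 \<Rightarrow> 'a" where
  "bracket x y = x $ 0 * y $ 1 - x $ 1 * y $ 0"

definition rank_one :: "'a::field^2 \<Rightarrow> 'a^2 \<Rightarrow> 'a^2^2" where
  "rank_one x a = mat2 (- (x $ 0 * a $ 1)) (x $ 0 * a $ 0) (- (x $ 1 * a $ 1)) (x $ 1 * a $ 0)"

definition form :: "'a::field^2^2 \<Rightarrow> 'a^2 \<Rightarrow> 'a^2 \<Rightarrow> 'a" where
  "form U x a = pairing U (rank_one x a)"

definition decomposition ::
    "(nat \<Rightarrow> 'a::field^2^2) \<Rightarrow> (nat \<Rightarrow> 'a^2^2) \<Rightarrow> (nat \<Rightarrow> 'a^2^2) \<Rightarrow> bool" where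
  "decomposition u v w \<longleftrightarrow> (\<forall>A B C. trace (A ** B ** C) =
     (\<Sum>s = 1..7. pairing (u s) A * pairing (v s) B * pairing (w s) C))"

definition vec2 :: "'a \<Rightarrow> 'a \<Rightarrow> 'a^2" where "vec2 p q = (\<chi> i. if i = 0 then p else q)"

lemma vec2_nth [simp]: "vec2 p q $ 0 = p" "vec2 p q $ 1 = q"
  by (simp_all add: vec2_def)

lemma form_expand:
  "form U x a = x$0 * (U$0$1 * a$0 - U$0$0 * a$1) + x$1 * (U$1$1 * a$0 - U$1$0 * a$1)"
  by (simp add: form_def pairing_def rank_one_def sum_two algebra_simps)

lemma trace_rank_one:
  "trace (rank_one x a ** rank_one y b ** rank_one z c) = bracket a y * bracket b z * bracket c x"
  by (simp add: two_simps rank_one_def bracket_def) algebra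

lemma trace_cyclic: "trace (A ** B ** C) = trace (B ** C ** A)" for A B C :: "'a::field^2^2"
  by (simp add: two_simps) algebra

lemma decomposition_cycle: "decomposition u v w \<Longrightarrow> decomposition v w u"
  unfolding decomposition_def by (subst trace_cyclic[symmetric]) (simp add: mult_ac)

lemma trace_transpose3:
  "trace (A ** B ** C) = trace (transpose C ** transpose B ** transpose A)"
  for A B C :: "'a::field^2^2"
  by (simp add: two_simps) algebra

lemma pairing_transpose: "pairing (transpose U) A = pairing U (transpose A)"
  by (simp add: pairing_def two_simps)

lemma decomposition_transpose:
  assumes "decomposition u v w"
  shows "decomposition (\<lambda>s. transpose (w s)) (\<lambda>s. transpose (v s)) (\<lambda>s. transpose (u s))"
  using assms unfolding decomposition_def
  by (subst trace_transpose3) (simp add: pairing_transpose mult_ac)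

text \<open>Transposing \<open>rank_one x a\<close> exchanges its two vectors; the quarter turns
  translate between a column and a row encoded through \<open>bracket\<close>.\<close>

lemma form_transpose: "form (transpose U) x a = form U (vec2 (- a$1) (a$0)) (vec2 (x$1) (- x$0))"
  by (simp add: form_expand two_simps) algebra

section \<open>Linear systems and degenerate forms\<close>

lemma homogeneous_system:
  fixes f :: "'i \<Rightarrow> 'j \<Rightarrow> 'a::field"
  assumes "finite I" "finite J" "card I < card J"
  shows "\<exists>c. (\<exists>j\<in>J. c j \<noteq> 0) \<and> (\<forall>i\<in>I. (\<Sum>j\<in>J. f i j * c j) = 0)"
  using assms
proof (induction I arbitrary: J f rule: finite_induct)
  case empty
  then have "J \<noteq> {}" by auto
  then show ?case by (intro exI[of _ "\<lambda>_. 1"]) auto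
next
  case (insert i0 I)
  show ?case
  proof (cases "\<forall>j\<in>J. f i0 j = 0")
    case True
    from insert have "card I < card J" by simp
    from insert.IH[OF insert.prems(1) this, of f] True show ?thesis by auto
  next
    case False
    then obtain j0 where j0: "j0 \<in> J" "f i0 j0 \<noteq> 0" by blast
    define J' where "J' = J - {j0}"
    have J': "finite J'" "card I < card J'" "j0 \<notin> J'" and J: "J = insert j0 J'"
      using insert j0 by (auto simp: J'_def)
    define g where "g i j = f i j - f i j0 * f i0 j / f i0 j0" for i j
    obtain c where c: "\<exists>j\<in>J'. c j \<noteq> 0" "\<forall>i\<in>I. (\<Sum>j\<in>J'. g i j * c j) = 0"
      using insert.IH[OF J'(1,2), of g] by blast
    define d where "d = c(j0 := - (\<Sum>j\<in>J'. f i0 j * c j) / f i0 j0)"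
    have sum_d: "(\<Sum>j\<in>J. f i j * d j)
        = (\<Sum>j\<in>J'. f i j * c j) - f i j0 * (\<Sum>j\<in>J'. f i0 j * c j) / f i0 j0" for i
    proof -
      have "(\<Sum>j\<in>J'. f i j * d j) = (\<Sum>j\<in>J'. f i j * c j)"
        using J'(3) by (intro sum.cong) (auto simp: d_def)
      then show ?thesis unfolding J using J' by (simp add: d_def)
    qed
    have "(\<Sum>j\<in>J. f i j * d j) = 0" if "i \<in> insert i0 I" for i
    proof (cases "i = i0")
      case True
      then show ?thesis using j0(2) unfolding sum_d by simp
    next
      case False
      with that have "(\<Sum>j\<in>J'. g i j * c j) = 0" using c(2) by simp
      moreover have "(\<Sum>j\<in>J'. g i j * c j)
          = (\<Sum>j\<in>J'. f i j * c j) - (\<Sum>j\<in>J'. f i j0 * (f i0 j * c j) / f i0 j0)"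
        unfolding sum_subtractf[symmetric] by (rule sum.cong) (auto simp: g_def left_diff_distrib)
      ultimately show ?thesis
        unfolding sum_d by (simp only: sum_distrib_left sum_divide_distrib)
    qed
    moreover have "\<exists>j\<in>J. d j \<noteq> 0" using c(1) J'(3) J by (auto simp: d_def)
    ultimately show ?thesis by blast
  qed
qed

text \<open>Four entries are the unknowns of at most three linear equations.\<close>

lemma common_zero:
  fixes f :: "'i \<Rightarrow> 'a::field^2^2"
  assumes "finite I" "card I \<le> 3"
  obtains A where "A \<noteq> 0" "\<And>i. i \<in> I \<Longrightarrow> pairing (f i) A = 0"
proof -
  have "card (UNIV :: (2 \<times> 2) set) = 4" by simp
  then obtain c :: "2 \<times> 2 \<Rightarrow> 'a" where c: "\<exists>j. c j \<noteq> 0"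
      "\<forall>i\<in>I. (\<Sum>j\<in>UNIV. f i $ fst j $ snd j * c j) = 0"
    using homogeneous_system[of I "UNIV :: (2 \<times> 2) set" "\<lambda>i j. f i $ fst j $ snd j"] assms by auto
  define A :: "'a^2^2" where "A = (\<chi> i j. c (i, j))"
  have "A \<noteq> 0" using c(1) by (auto simp: A_def vec_eq_iff)
  moreover have "pairing (f i) A = 0" if "i \<in> I" for i
  proof -
    have "pairing (f i) A = (\<Sum>j\<in>UNIV \<times> UNIV. f i $ fst j $ snd j * c j)"
      by (simp add: pairing_def A_def sum.cartesian_product case_prod_unfold)
    with c(2) that show ?thesis by simp
  qed
  ultimately show ?thesis using that by blast
qed

lemma three_unknowns:
  fixes f :: "'i \<Rightarrow> nat \<Rightarrow> 'a::field"
  assumes "finite I" "card I \<le> 2"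
  obtains p q r where "p \<noteq> 0 \<or> q \<noteq> 0 \<or> r \<noteq> 0"
    "\<And>i. i \<in> I \<Longrightarrow> f i 0 * p + f i 1 * q + f i 2 * r = 0"
proof -
  obtain c where c: "\<exists>j\<in>{0,1,2}. c j \<noteq> 0" "\<forall>i\<in>I. (\<Sum>j\<in>{0,1,2}. f i j * c j) = 0"
    using homogeneous_system[of I "{0,1,2::nat}" f] assms by auto
  show ?thesis using c by (intro that[of "c 0" "c 1" "c 2"]) (auto simp: add.assoc)
qed

lemma kernel_two:
  fixes p q :: "'a::field"
  obtains z :: "'a^2" where "z \<noteq> 0" "p * z$0 + q * z$1 = 0"
proof (cases "p = 0")
  case True
  then show ?thesis by (intro that[of "vec2 1 0"]) (auto simp: vec2_eq_iff)
next
  case False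
  then show ?thesis by (intro that[of "vec2 (-q) p"]) (auto simp: vec2_eq_iff)
qed

lemma form_kernel_right: obtains b :: "'a::field^2" where "b \<noteq> 0" "form U y b = 0"
proof -
  obtain b :: "'a^2" where "b \<noteq> 0"
    "(y$0 * U$0$1 + y$1 * U$1$1) * b$0 + (- y$0 * U$0$0 - y$1 * U$1$0) * b$1 = 0"
    by (rule kernel_two)
  then show ?thesis by (intro that[of b]) (auto simp: form_expand algebra_simps)
qed

lemma form_kernel_left: obtains x :: "'a::field^2" where "x \<noteq> 0" "form U x a = 0"
proof -
  obtain x :: "'a^2" where "x \<noteq> 0"
    "(U$0$1 * a$0 - U$0$0 * a$1) * x$0 + (U$1$1 * a$0 - U$1$0 * a$1) * x$1 = 0"
    by (rule kernel_two)
  then show ?thesis by (intro that[of x]) (auto simp: form_expand algebra_simps)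
qed

lemma bracket_right: assumes "a \<noteq> 0" obtains y where "bracket a y \<noteq> 0"
proof (cases "a$0 = 0")
  case True
  then show ?thesis using assms by (intro that[of "vec2 1 0"]) (auto simp: vec2_eq_iff bracket_def)
next
  case False
  then show ?thesis by (intro that[of "vec2 0 1"]) (auto simp: vec2_eq_iff bracket_def)
qed

lemma bracket_commute: "bracket a b = - bracket b a"
  by (simp add: bracket_def)

lemma bracket_self [simp]: "bracket a a = 0"
  by (simp add: bracket_def)

lemma bracket_left: assumes "a \<noteq> 0" obtains y where "bracket y a \<noteq> 0"
  using bracket_right[OF assms] by (metis bracket_commute neg_equal_0_iff_equal)

lemma bracket_eq_0:
  assumes "bracket a b = 0" "b \<noteq> 0" obtains k where "a = k *s b"
proof (cases "b$0 = 0")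
  case True
  with assms have "b$1 \<noteq> 0" by (auto simp: vec2_eq_iff)
  with assms True show ?thesis
    by (intro that[of "a$1 / b$1"]) (auto simp: vec2_eq_iff bracket_def)
next
  case False
  with assms show ?thesis
    by (intro that[of "a$0 / b$0"]) (auto simp: vec2_eq_iff bracket_def field_simps)
qed

lemma form_scale_left: "form U (k *s x) a = k * form U x a"
  and form_scale_right: "form U x (k *s a) = k * form U x a"
  by (simp_all add: form_expand algebra_simps)

section \<open>Restriction of the trace to rank one matrices\<close>

definition support :: "(nat \<Rightarrow> 'a::field^2^2) \<Rightarrow> 'a^2 \<Rightarrow> 'a^2 \<Rightarrow> nat set" where
  "support u x a = {s \<in> {1..7}. form (u s) x a \<noteq> 0}"

lemma support_subset: "support u x a \<subseteq> {1..7}" and finite_support: "finite (support u x a)"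
  by (auto simp: support_def)

lemma decomposition_support:
  assumes "decomposition u v w"
  shows "(\<Sum>s\<in>support u x a. form (u s) x a * pairing (v s) B * pairing (w s) C)
    = trace (rank_one x a ** B ** C)"
proof -
  have "trace (rank_one x a ** B ** C)
      = (\<Sum>s = 1..7. form (u s) x a * pairing (v s) B * pairing (w s) C)"
    using assms by (simp add: decomposition_def form_def)
  also have "\<dots> = (\<Sum>s\<in>support u x a. form (u s) x a * pairing (v s) B * pairing (w s) C)"
    by (rule sum.mono_neutral_right) (auto simp: support_def)
  finally show ?thesis by simp
qed

lemma decomposition_support_form:
  assumes "decomposition u v w"
  shows "(\<Sum>s\<in>support u x a. form (u s) x a * form (v s) y b * form (w s) z c)
    = bracket a y * bracket b z * bracket c x"
  using decomposition_support[OF assms, of x a "rank_one y b" "rank_one z c"]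
  by (simp add: form_def trace_rank_one)

text \<open>A cyclic shift brings \<open>rank_one z x\<close> next to \<open>rank_one x a\<close>,
  and their product is zero because \<open>bracket x x = 0\<close>.\<close>

lemma trace_rank_one_middle_eq_0: "trace (rank_one x a ** B ** rank_one z x) = 0"
  by (simp add: two_simps rank_one_def) algebra

lemma rank_one_eq_0: "rank_one x a = 0 \<longleftrightarrow> x = 0 \<or> a = 0"
  by (auto simp: two_simps rank_one_def)


text \<open>If \<open>bracket a y \<noteq> 0\<close>, the products
  \<open>rank_one x a ** rank_one y b\<close> are nonzero multiples of \<open>rank_one x b\<close>,
  and these span all matrices.\<close>

lemma trace_left_nondegenerate:
  fixes C :: "'a::field^2^2"
  assumes "a \<noteq> 0" "\<And>x B. trace (rank_one x a ** B ** C) = 0"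
  shows "C = 0"
proof -
  obtain y where y: "bracket a y \<noteq> 0" using bracket_right[OF assms(1)] .
  have "trace (rank_one x a ** rank_one y b ** C)
      = bracket a y * (b$0 * (C$1$0 * x$0 + C$1$1 * x$1) - b$1 * (C$0$0 * x$0 + C$0$1 * x$1))"
    for x b :: "'a^2" by (simp add: two_simps rank_one_def bracket_def) algebra
  with assms(2) y have *: "b$0 * (C$1$0 * x$0 + C$1$1 * x$1) = b$1 * (C$0$0 * x$0 + C$0$1 * x$1)"
    for x b :: "'a^2" by simp
  show ?thesis
    using *[of "vec2 1 0" "vec2 1 0"] *[of "vec2 1 0" "vec2 0 1"] *[of "vec2 0 1" "vec2 1 0"]
      *[of "vec2 0 1" "vec2 0 1"] by (simp add: two_simps)
qed

lemma trace_right_nondegenerate: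
  fixes C :: "'a::field^2^2"
  assumes "a \<noteq> 0" "\<And>A b. trace (A ** rank_one a b ** C) = 0"
  shows "C = 0"
proof -
  obtain y where y: "bracket a y \<noteq> 0" using bracket_right[OF assms(1)] .
  have "trace (rank_one x y ** rank_one a b ** C)
      = bracket y a * (b$0 * (C$1$0 * x$0 + C$1$1 * x$1) - b$1 * (C$0$0 * x$0 + C$0$1 * x$1))"
    for x b :: "'a^2" by (simp add: two_simps rank_one_def bracket_def) algebra
  with assms(2) y have *: "b$0 * (C$1$0 * x$0 + C$1$1 * x$1) = b$1 * (C$0$0 * x$0 + C$0$1 * x$1)"
    for x b :: "'a^2" by (metis bracket_commute eq_iff_diff_eq_0 mult_eq_0_iff neg_equal_0_iff_equal)
  show ?thesis
    using *[of "vec2 1 0" "vec2 1 0"] *[of "vec2 1 0" "vec2 0 1"] *[of "vec2 0 1" "vec2 1 0"]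
      *[of "vec2 0 1" "vec2 0 1"] by (simp add: two_simps)
qed

text \<open>If three \<open>u s\<close> vanished on all \<open>rank_one x a\<close>, only the four
  terms of \<open>R\<close> would remain there. Killing three of these through \<open>C\<close>
  isolates each in turn and shows that its \<open>v s\<close> vanishes on all
  \<open>rank_one a b\<close>. On those matrices only the three terms of \<open>Z\<close> are left,
  and one nonzero \<open>C\<close> kills them all, against nondegeneracy of the trace.\<close>

lemma card_right_vanishing:
  assumes D: "decomposition u v w" and a: "a \<noteq> 0"
  shows "card {s \<in> {1..7}. \<forall>x. form (u s) x a = 0} \<le> 2"
proof (rule ccontr)
  assume "\<not> ?thesis"
  then have "3 \<le> card {s \<in> {1..7}. \<forall>x. form (u s) x a = 0}" by simp
  then obtain Z where Z: "Z \<subseteq> {s \<in> {1..7}. \<forall>x. form (u s) x a = 0}" "card Z = 3" "finite Z"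
    by (rule obtain_subset_with_card_n)
  define R where "R = {1..7} - Z"
  have Z7: "Z \<subseteq> {1..7}" and uZ: "\<And>s x. s \<in> Z \<Longrightarrow> form (u s) x a = 0" using Z by auto
  have R: "finite R" "card R = 4" using Z Z7 by (auto simp: R_def card_Diff_subset)
  have D: "trace (A ** B ** C)
      = (\<Sum>s\<in>R. pairing (u s) A * pairing (v s) B * pairing (w s) C)
      + (\<Sum>s\<in>Z. pairing (u s) A * pairing (v s) B * pairing (w s) C)" for A B C
    using D Z7 unfolding decomposition_def R_def by (simp add: sum.subset_diff)
  have vR: "form (v s) a b = 0" if s: "s \<in> R" for s b
  proof -
    have "card (R - {s}) \<le> 3" using R s by simp
    with R obtain C where C: "C \<noteq> 0" "\<And>t. t \<in> R - {s} \<Longrightarrow> pairing (w t) C = 0"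
      using common_zero[of "R - {s}" w] by blast
    have tr: "trace (rank_one x a ** B ** C) = form (u s) x a * pairing (v s) B * pairing (w s) C"
      for x B
    proof -
      have "(\<Sum>t\<in>R. pairing (u t) (rank_one x a) * pairing (v t) B * pairing (w t) C)
        = (\<Sum>t\<in>{s}. pairing (u t) (rank_one x a) * pairing (v t) B * pairing (w t) C)"
        by (rule sum.mono_neutral_right) (use R s C in auto)
      then show ?thesis unfolding D using uZ by (simp add: form_def)
    qed
    obtain x B where "trace (rank_one x a ** B ** C) \<noteq> 0"
      using trace_left_nondegenerate[OF a] C(1) by blast
    then have nz: "form (u s) x a \<noteq> 0" "pairing (w s) C \<noteq> 0" unfolding tr by auto
    \<comment> \<open>The first two factors already multiply to zero, while in the one surviving
      term only the factor of \<open>v s\<close> can vanish.\<close>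
    have "trace (rank_one x a ** rank_one a b ** C) = 0"
      by (simp add: two_simps rank_one_def)
    with nz show ?thesis unfolding tr by (simp add: form_def)
  qed
  obtain C where C: "C \<noteq> 0" "\<And>t. t \<in> Z \<Longrightarrow> pairing (w t) C = 0"
    using common_zero[of Z w] Z by auto
  have "trace (A ** rank_one a b ** C) = 0" for A b
    unfolding D using vR C by (simp add: form_def)
  then show False using trace_right_nondegenerate[OF a] C(1) by blast
qed

text \<open>Transposition reverses the product, so \<open>w\<close> takes the first place and left
  and right vectors are exchanged; \<open>a\<close> is \<open>x\<close> after a quarter
  turn.\<close>

lemma card_left_vanishing:
  assumes D: "decomposition u v w" and x: "x \<noteq> 0"
  shows "card {s \<in> {1..7}. \<forall>a. form (w s) x a = 0} \<le> 2"
proof -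
  define a where "a = vec2 (- x$1) (x$0)"
  have "a \<noteq> 0" using x by (auto simp: a_def vec2_eq_iff)
  have "(\<forall>b. form (w s) x b = 0) \<longleftrightarrow> (\<forall>y. form (transpose (w s)) y a = 0)" for s
  proof -
    have *: "form (transpose (w s)) y a = - form (w s) x (vec2 (y$1) (- y$0))" for y
      by (simp add: form_transpose a_def) (simp add: form_expand algebra_simps)
    have **: "form (w s) x b = - form (transpose (w s)) (vec2 (- b$1) (b$0)) a" for b
      unfolding * by (simp add: form_expand)
    show ?thesis using * ** by (metis neg_equal_0_iff_equal)
  qed
  with card_right_vanishing[OF decomposition_transpose[OF D] \<open>a \<noteq> 0\<close>] show ?thesis by simp
qed

section \<open>Terms that survive at a rank one matrix\<close>

text \<open>A single surviving term could be killed by a choice of \<open>b\<close> alone, while the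
  product of brackets stays nonzero for suitable \<open>y\<close>, \<open>z\<close>,
  \<open>c\<close>.\<close>

lemma card_support_ge_2:
  assumes D: "decomposition u v w" and xa: "x \<noteq> 0" "a \<noteq> 0"
  shows "2 \<le> card (support u x a)"
proof (rule ccontr)
  assume "\<not> ?thesis"
  then have "card (support u x a) \<le> Suc 0" by simp
  then have "\<forall>s\<in>support u x a. \<forall>t\<in>support u x a. s = t"
    using card_le_Suc0_iff_eq[OF finite_support] by blast
  then obtain s where s: "support u x a \<subseteq> {s}" by blast
  obtain y where y: "bracket a y \<noteq> 0" using bracket_right[OF xa(2)] .
  obtain c where c: "bracket c x \<noteq> 0" using bracket_left[OF xa(1)] .
  obtain b where b: "b \<noteq> 0" "form (v s) y b = 0" by (rule form_kernel_right)
  obtain z where z: "bracket b z \<noteq> 0" using bracket_right[OF b(1)] .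
  have "(\<Sum>r\<in>support u x a. form (u r) x a * form (v r) y b * form (w r) z c) = 0"
    using s b(2) by (intro sum.neutral) auto
  with y c z show False unfolding decomposition_support_form[OF D] by simp
qed

text \<open>Choosing \<open>b0\<close> in the kernel of the form of \<open>t\<close> leaves the term
  of \<open>s\<close> alone. It then equals a product of brackets, so \<open>w s\<close> is
  proportional to \<open>bracket b0 z * bracket c x\<close>, which vanishes at \<open>c = x\<close>.
  The argument for \<open>v s\<close> is symmetric.\<close>

lemma support_pair:
  assumes D: "decomposition u v w" and xa: "x \<noteq> 0" "a \<noteq> 0"
    and N: "support u x a = {s, t}" "s \<noteq> t"
  shows "form (v s) a b = 0" and "form (w s) z x = 0"
    and "\<exists>y b. form (v s) y b \<noteq> 0" and "\<exists>z c. form (w s) z c \<noteq> 0"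
proof -
  note E = decomposition_support_form[OF D, of x a, unfolded N(1)]
  obtain y0 where y0: "bracket a y0 \<noteq> 0" using bracket_right[OF xa(2)] .
  obtain c0 where c0: "bracket c0 x \<noteq> 0" using bracket_left[OF xa(1)] .
  obtain b0 where b0: "b0 \<noteq> 0" "form (v t) y0 b0 = 0" by (rule form_kernel_right)
  obtain z0 where z0: "z0 \<noteq> 0" "form (w t) z0 c0 = 0" by (rule form_kernel_left)
  obtain z1 where z1: "bracket b0 z1 \<noteq> 0" using bracket_right[OF b0(1)] .
  obtain b1 where b1: "bracket b1 z0 \<noteq> 0" using bracket_left[OF z0(1)] .
  have Ez: "form (u s) x a * form (v s) y0 b0 * form (w s) z c
      = bracket a y0 * bracket b0 z * bracket c x" for z c
    using E[of y0 b0 z c] N(2) b0(2) by simp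
  have Eb: "form (u s) x a * form (v s) y b * form (w s) z0 c0
      = bracket a y * bracket b z0 * bracket c0 x" for y b
    using E[of y b z0 c0] N(2) z0(2) by simp
  have nz: "form (u s) x a * form (v s) y0 b0 * form (w s) z1 c0 \<noteq> 0"
    "form (u s) x a * form (v s) y0 b1 * form (w s) z0 c0 \<noteq> 0"
    unfolding Ez Eb using y0 z1 c0 b1 by auto
  show "form (w s) z x = 0" using Ez[of z x] nz by auto
  show "form (v s) a b = 0" using Eb[of a b] nz by auto
  show "\<exists>y b. form (v s) y b \<noteq> 0" "\<exists>z c. form (w s) z c \<noteq> 0" using nz by auto
qed

lemma exists_not_right_vanishing:
  assumes "decomposition u v w" "a \<noteq> 0" "N \<subseteq> {1..7}" "3 \<le> card N"
  shows "\<exists>s\<in>N. \<exists>x. form (u s) x a \<noteq> 0"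
proof (rule ccontr)
  assume "\<not> ?thesis"
  then have "N \<subseteq> {s \<in> {1..7}. \<forall>x. form (u s) x a = 0}" using assms(3) by blast
  then have "card N \<le> card {s \<in> {1..7}. \<forall>x. form (u s) x a = 0}" by (intro card_mono) auto
  with card_right_vanishing[OF assms(1,2)] assms(4) show False by simp
qed

lemma exists_not_left_vanishing:
  assumes "decomposition u v w" "a \<noteq> 0" "N \<subseteq> {1..7}" "3 \<le> card N"
  shows "\<exists>s\<in>N. \<exists>b. form (v s) a b \<noteq> 0"
proof (rule ccontr)
  have D: "decomposition w u v" using assms(1) decomposition_cycle by blast
  assume "\<not> ?thesis"
  then have "N \<subseteq> {s \<in> {1..7}. \<forall>b. form (v s) a b = 0}" using assms(3) by blast
  then have "card N \<le> card {s \<in> {1..7}. \<forall>b. form (v s) a b = 0}" by (intro card_mono) auto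
  with card_left_vanishing[OF D assms(2)] assms(4) show False by simp
qed

lemma pairing_add: "pairing U (A + B) = pairing U A + pairing U B"
  by (simp add: pairing_def sum_two algebra_simps)

text \<open>A three-parameter family of matrices survives two linear conditions. The trace detects
  the parameters \<open>q\<close>, \<open>r\<close>, and \<open>v s0\<close> detects
  \<open>p\<close>, so the \<open>v s\<close> of the support have no common nonzero member of the
  family.\<close>

lemma matrix_separating_two:
  assumes D: "decomposition u v w" and xa: "x \<noteq> 0" "a \<noteq> 0"
    and N: "3 \<le> card (support u x a)" and E: "finite E" "card E \<le> 2"
  shows "\<exists>B. (\<exists>s\<in>support u x a. pairing (v s) B \<noteq> 0) \<and> (\<forall>t\<in>E. pairing (v t) B = 0)"
proof -
  obtain s0 b0 where s0: "s0 \<in> support u x a" "form (v s0) a b0 \<noteq> 0"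
    using exists_not_left_vanishing[OF D xa(2) support_subset N] by blast
  obtain y0 where y0: "bracket a y0 \<noteq> 0" using bracket_right[OF xa(2)] .
  obtain c0 where c0: "bracket c0 x \<noteq> 0" using bracket_left[OF xa(1)] .
  define f where "f t = (\<lambda>j::nat. if j = 0 then form (v t) a b0
      else if j = 1 then form (v t) y0 (vec2 1 0) else form (v t) y0 (vec2 0 1))" for t
  obtain p q r where pqr: "p \<noteq> 0 \<or> q \<noteq> 0 \<or> r \<noteq> 0"
      and 0: "\<And>t. t \<in> E \<Longrightarrow> f t 0 * p + f t 1 * q + f t 2 * r = 0"
    using three_unknowns[OF E, of f] by blast
  define B where "B = rank_one (p *s a) b0 + rank_one y0 (vec2 q r)"
  have vB: "pairing (v t) B = f t 0 * p + f t 1 * q + f t 2 * r" for t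
  proof -
    have "pairing (v t) B = p * form (v t) a b0 + form (v t) y0 (vec2 q r)"
      unfolding B_def pairing_add form_def[symmetric] by (simp add: form_scale_left)
    also have "form (v t) y0 (vec2 q r) = f t 1 * q + f t 2 * r"
      by (simp add: f_def form_expand algebra_simps)
    finally show ?thesis by (simp add: f_def)
  qed
  have "\<exists>s\<in>support u x a. pairing (v s) B \<noteq> 0"
  proof (rule ccontr)
    assume "\<not> ?thesis"
    then have zero: "\<And>s. s \<in> support u x a \<Longrightarrow> pairing (v s) B = 0" by blast
    have "trace (rank_one x a ** B ** rank_one z c) = 0" for z c
      unfolding decomposition_support[OF D, symmetric] using zero by simp
    moreover have "trace (rank_one x a ** B ** rank_one z c)
        = bracket a y0 * bracket (vec2 q r) z * bracket c x" for z c
      by (simp add: B_def two_simps rank_one_def bracket_def) algebra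
    ultimately have "bracket (vec2 q r) z = 0" for z using y0 c0
      by (metis mult_eq_0_iff)
    then have "vec2 q r = 0" using bracket_right by metis
    then have qr: "q = 0" "r = 0" by (auto simp: vec2_eq_iff)
    with pqr have "p \<noteq> 0" by simp
    with zero[OF s0(1)] qr s0(2) show False unfolding vB by (simp add: f_def)
  qed
  moreover have "\<forall>t\<in>E. pairing (v t) B = 0" using vB 0 by simp
  ultimately show ?thesis by blast
qed

lemma support_relation:
  assumes "decomposition u v w"
  shows "(\<Sum>s\<in>support u x a. form (u s) x a * pairing (v s) B * form (w s) z x) = 0"
  using decomposition_support[OF assms, of x a B "rank_one z x"] trace_rank_one_middle_eq_0
  by (simp add: form_def)

text \<open>With three terms, some \<open>w t\<close> is nonzero at \<open>z0\<close>,
  \<open>x\<close>. A matrix \<open>B\<close> killed by the other two \<open>v\<close>'s leaves only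
  the term of \<open>t\<close> in \<open>support_relation\<close>, so \<open>v t\<close> kills
  \<open>B\<close> as well, against the choice of \<open>B\<close>.\<close>

lemma card_support_neq_3:
  assumes D: "decomposition u v w" and xa: "x \<noteq> 0" "a \<noteq> 0"
  shows "card (support u x a) \<noteq> 3"
proof
  assume N: "card (support u x a) = 3"
  have D': "decomposition w u v" using D decomposition_cycle by blast
  obtain t z0 where t: "t \<in> support u x a" "form (w t) z0 x \<noteq> 0"
    using exists_not_right_vanishing[OF D' xa(1) support_subset[of u x a]] N by auto
  have E: "finite (support u x a - {t})" "card (support u x a - {t}) \<le> 2"
    using N t finite_support[of u x a] by auto
  obtain B s where B: "s \<in> support u x a" "pairing (v s) B \<noteq> 0"
    "\<And>r. r \<in> support u x a - {t} \<Longrightarrow> pairing (v r) B = 0"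
    using matrix_separating_two[OF D xa _ E] N by auto
  have "(\<Sum>s\<in>support u x a. form (u s) x a * pairing (v s) B * form (w s) z0 x)
      = (\<Sum>s\<in>{t}. form (u s) x a * pairing (v s) B * form (w s) z0 x)"
    using B t by (intro sum.mono_neutral_right finite_support) auto
  then have "form (u t) x a * pairing (v t) B * form (w t) z0 x = 0"
    unfolding support_relation[OF D] by simp
  moreover have "form (u t) x a \<noteq> 0" using t(1) by (simp add: support_def)
  ultimately have "pairing (v t) B = 0" using t(2) by simp
  with B show False by blast
qed

text \<open>A matrix \<open>B\<close> seen only by \<open>t\<close> and \<open>t'\<close> turns
  \<open>support_relation\<close> into a linear dependence between the functionals of
  \<open>w t\<close> and \<open>w t'\<close> in \<open>z\<close>. Hence all these functionals on the
  plane are proportional and share a kernel vector.\<close>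

lemma exists_dual_point:
  assumes D: "decomposition u v w" and xa: "x \<noteq> 0" "a \<noteq> 0"
    and sep: "\<And>t t'. t \<in> support u x a \<Longrightarrow> t' \<in> support u x a \<Longrightarrow> t \<noteq> t' \<Longrightarrow>
      \<exists>B. (\<exists>s\<in>support u x a. pairing (v s) B \<noteq> 0)
        \<and> (\<forall>s\<in>support u x a - {t, t'}. pairing (v s) B = 0)"
  obtains z where "z \<noteq> 0" "\<And>s. s \<in> support u x a \<Longrightarrow> form (w s) z x = 0"
proof (cases "\<forall>s\<in>support u x a. form (w s) (vec2 1 0) x = 0")
  case True
  show ?thesis by (rule that[of "vec2 1 0"]) (use True in \<open>auto simp: vec2_eq_iff\<close>)
next
  case False
  then obtain t where t: "t \<in> support u x a" "form (w t) (vec2 1 0) x \<noteq> 0" by blast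
  define z where "z = vec2 (form (w t) (vec2 0 1) x) (- form (w t) (vec2 1 0) x)"
  have "z \<noteq> 0" using t(2) by (simp add: z_def vec2_eq_iff)
  have wt: "form (w t) z x = 0" by (simp add: z_def form_expand algebra_simps)
  have "form (w t') z x = 0" if t': "t' \<in> support u x a" for t'
  proof (rule ccontr)
    assume nz: "form (w t') z x \<noteq> 0"
    with wt have "t \<noteq> t'" by auto
    from sep[OF t(1) t' this] obtain B s where s: "s \<in> support u x a" "pairing (v s) B \<noteq> 0"
      and B: "\<And>s. s \<in> support u x a - {t, t'} \<Longrightarrow> pairing (v s) B = 0" by blast
    have rel: "form (u t) x a * pairing (v t) B * form (w t) z x
        + form (u t') x a * pairing (v t') B * form (w t') z x = 0" for z
    proof -
      have "(\<Sum>s\<in>support u x a. form (u s) x a * pairing (v s) B * form (w s) z x)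
          = (\<Sum>s\<in>{t, t'}. form (u s) x a * pairing (v s) B * form (w s) z x)"
        using B t t' by (intro sum.mono_neutral_right finite_support) auto
      then show ?thesis unfolding support_relation[OF D] using \<open>t \<noteq> t'\<close> by simp
    qed
    have nz_u: "form (u t) x a \<noteq> 0" "form (u t') x a \<noteq> 0"
      using t(1) t' by (simp_all add: support_def)
    from rel[of z] wt nz nz_u have "pairing (v t') B = 0" by simp
    with rel[of "vec2 1 0"] t(2) nz_u have "pairing (v t) B = 0" by simp
    with \<open>pairing (v t') B = 0\<close> B s show False by blast
  qed
  with \<open>z \<noteq> 0\<close> that show ?thesis by blast
qed

definition pair_point :: "(nat \<Rightarrow> 'a::field^2^2) \<Rightarrow> nat \<Rightarrow> nat \<Rightarrow> 'a^2 \<Rightarrow> 'a^2 \<Rightarrow> bool" where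
  "pair_point u s t x a \<longleftrightarrow> x \<noteq> 0 \<and> a \<noteq> 0 \<and> s \<noteq> t \<and> support u x a = {s, t}"

lemma card_complement_support: "card ({1..7} - support u x a) = 7 - card (support u x a)"
  using card_Diff_subset[OF finite_support[of u x a] support_subset[of u x a]] by simp

text \<open>The dual point has its support in the complement of the given one, which has three or
  two elements. As supports have at least two elements and never three, exactly two remain.\<close>

lemma dual_pair_point:
  assumes D: "decomposition u v w" and xa: "x \<noteq> 0" "a \<noteq> 0"
    and N: "card (support u x a) = 4 \<or> card (support u x a) = 5 \<and>
      (\<forall>B. (\<forall>s\<in>support u x a. pairing (v s) B = 0) \<longrightarrow> B = 0)"
  obtains z s t where "pair_point w s t z x" "{s, t} \<subseteq> {1..7} - support u x a"
proof -
  have D': "decomposition w u v" using D decomposition_cycle by blast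
  have "\<exists>B. (\<exists>s\<in>support u x a. pairing (v s) B \<noteq> 0)
      \<and> (\<forall>s\<in>support u x a - {t, t'}. pairing (v s) B = 0)"
    if t: "t \<in> support u x a" "t' \<in> support u x a" "t \<noteq> t'" for t t'
  proof -
    let ?E = "support u x a - {t, t'}"
    have cE: "finite ?E" "card ?E = card (support u x a) - 2"
      using t finite_support[of u x a] by (simp_all add: card_Diff_subset)
    show ?thesis
    proof (cases "card (support u x a) = 4")
      case True
      with cE have "card ?E \<le> 2" "3 \<le> card (support u x a)" by simp_all
      then show ?thesis using matrix_separating_two[OF D xa _ cE(1)] by blast
    next
      case False
      with N have 5: "card (support u x a) = 5"
        and inj: "\<And>B. (\<forall>s\<in>support u x a. pairing (v s) B = 0) \<Longrightarrow> B = 0" by auto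
      obtain B where "B \<noteq> 0" "\<And>s. s \<in> ?E \<Longrightarrow> pairing (v s) B = 0"
        using common_zero[of ?E v] cE 5 by auto
      with inj show ?thesis by blast
    qed
  qed
  then obtain z where z: "z \<noteq> 0" "\<And>s. s \<in> support u x a \<Longrightarrow> form (w s) z x = 0"
    using exists_dual_point[OF D xa] by blast
  have sub: "support w z x \<subseteq> {1..7} - support u x a" using z(2) by (auto simp: support_def)
  then have "card (support w z x) \<le> 7 - card (support u x a)"
    unfolding card_complement_support[symmetric] by (intro card_mono) auto
  with N card_support_ge_2[OF D' z(1) xa(1)] card_support_neq_3[OF D' z(1) xa(1)]
  have "card (support w z x) = 2" by auto
  then obtain s t where "support w z x = {s, t}" "s \<noteq> t" by (auto simp: card_2_iff)
  with sub z(1) xa(1) that[of s t z] show ?thesis by (simp add: pair_point_def)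
qed

lemma pair_point_swap: "pair_point u s t x a \<Longrightarrow> pair_point u t s x a"
  by (auto simp: pair_point_def)

section \<open>Singular matrices in a pencil\<close>

lemma two_cases: "p = 0 \<or> p = 1" for p :: 2
  using UNIV_two by auto

lemma rank_one_of_singular:
  assumes "A \<noteq> 0" "A$0$0 * A$1$1 = A$0$1 * A$1$0"
  obtains x a where "A = rank_one x a"
proof -
  consider "A$0$0 \<noteq> 0" | "A$0$1 \<noteq> 0" | "A$0$0 = 0" "A$0$1 = 0" by blast
  then show ?thesis
  proof cases
    case 1
    with assms show ?thesis
      by (intro that[of "vec2 1 (A$1$0 / A$0$0)" "vec2 (A$0$1) (- A$0$0)"])
        (auto simp: two_simps rank_one_def field_simps)
  next
    case 2
    with assms show ?thesis
      by (intro that[of "vec2 1 (A$1$1 / A$0$1)" "vec2 (A$0$1) (- A$0$0)"])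
        (auto simp: two_simps rank_one_def field_simps)
  next
    case 3
    then show ?thesis
      by (intro that[of "vec2 0 1" "vec2 (A$1$1) (- A$1$0)"])
        (auto simp: two_simps rank_one_def)
  qed
qed

lemma trace_nondegenerate:
  fixes X :: "'a::field^2^2"
  assumes "\<And>C. trace (X ** C) = 0"
  shows "X = 0"
  using assms[of "mat2 1 0 0 0"] assms[of "mat2 0 1 0 0"] assms[of "mat2 0 0 1 0"]
    assms[of "mat2 0 0 0 1"] by (simp add: two_simps)

text \<open>Multiplying by the adjugate of \<open>A\<close> turns either product into \<delta> times
  \<open>B\<close>.\<close>

lemma regular_mult_eq_0:
  fixes A B :: "'a::field^2^2"
  defines "\<delta> \<equiv> A$0$0 * A$1$1 - A$0$1 * A$1$0"
  shows "(A ** B = 0 \<or> B ** A = 0) \<and> \<delta> \<noteq> 0 \<Longrightarrow> B = 0"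
proof -
  assume *: "(A ** B = 0 \<or> B ** A = 0) \<and> \<delta> \<noteq> 0"
  have "\<delta> * B$0$0 = 0 \<and> \<delta> * B$0$1 = 0 \<and> \<delta> * B$1$0 = 0 \<and> \<delta> * B$1$1 = 0"
    using * unfolding \<delta>_def two_simps zero_index
    by (elim conjE disjE; intro conjI; algebra)
  with * show ?thesis by (simp add: two_simps)
qed

lemma pairing_diff: "pairing U (A - B) = pairing U A - pairing U B"
  by (simp add: pairing_def sum_two algebra_simps)

lemma pairing_mult_left: "pairing U (M ** B) = pairing (transpose M ** U) B"
  for M B :: "'a::field^2^2"
  by (simp add: pairing_def two_simps algebra_simps)

lemma common_zero_three:
  fixes U V W :: "'a::field^2^2"
  obtains A where "A \<noteq> 0" "pairing U A = 0" "pairing V A = 0" "pairing W A = 0"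
proof -
  obtain A where "A \<noteq> 0" and A: "\<And>r. r \<in> {0, 1, 2::nat} \<Longrightarrow> pairing ([U, V, W] ! r) A = 0"
    by (rule common_zero[of "{0, 1, 2::nat}" "\<lambda>r. [U, V, W] ! r"]) simp_all
  with A[of 0] A[of 1] A[of 2] that show ?thesis by simp
qed

text \<open>
  Over a field that is not closed a pencil of matrices need not contain a singular one.  Here it
  does: if \<open>A0\<close> is a regular common zero of three \<open>u\<close>'s, the remaining four terms diagonalize
  multiplication by \<open>A0\<close>, and for \<open>A1\<close> in the pencil the characteristic polynomial of
  \<open>inverse A0 ** A1\<close> has a diagonal entry \<open>d\<close> as a root.
\<close>

lemma singular_common_zero:
  assumes D: "decomposition u v w" and ij: "i \<in> {1..7}" "j \<in> {1..7}" "i \<noteq> j"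
  obtains x a where "x \<noteq> 0" "a \<noteq> 0" "form (u i) x a = 0" "form (u j) x a = 0"
    "card (support u x a) \<le> 4 \<or> card (support u x a) = 5 \<and>
      (\<forall>B. (\<forall>s\<in>support u x a. pairing (v s) B = 0) \<longrightarrow> B = 0)"
proof -
  have "card ({1..7} - {i, j}) = 5" using ij by (simp add: card_Diff_subset)
  then have "{1..7} - {i, j} \<noteq> {}" by (metis card.empty zero_neq_numeral)
  then obtain k where k: "k \<in> {1..7}" "k \<noteq> i" "k \<noteq> j" by blast
  define R where "R = {1..7} - {i, j, k}"
  have R: "finite R" "card R = 4" using ij k by (auto simp: R_def card_Diff_subset)
  obtain A0 where A0: "A0 \<noteq> 0"
      and uA0: "pairing (u i) A0 = 0" "pairing (u j) A0 = 0" "pairing (u k) A0 = 0"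
    using common_zero_three[of "u i" "u j" "u k"] .
  show ?thesis
  proof (cases "A0$0$0 * A0$1$1 = A0$0$1 * A0$1$0")
    case True
    then obtain x a where xa: "A0 = rank_one x a" using rank_one_of_singular A0 by blast
    then have "x \<noteq> 0" "a \<noteq> 0" using A0 by (auto simp: rank_one_eq_0)
    moreover have "support u x a \<subseteq> R" using uA0 by (auto simp: support_def R_def form_def xa)
    then have "card (support u x a) \<le> 4" using card_mono R by metis
    ultimately show ?thesis using that[of x a] uA0 by (simp add: form_def xa)
  next
    case False
    define \<delta> where "\<delta> = A0$0$0 * A0$1$1 - A0$0$1 * A0$1$0"
    have \<delta>: "\<delta> \<noteq> 0" using False by (simp add: \<delta>_def)
    have regular: "A0 ** B = 0 \<or> B ** A0 = 0 \<Longrightarrow> B = 0" for B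
      using regular_mult_eq_0[of A0 B] \<delta> by (simp add: \<delta>_def)
    obtain p q where pq: "A0$p$q \<noteq> 0" using A0 by (auto simp: vec_eq_iff)
    \<comment> \<open>\<open>E\<close> reads off an entry at which \<open>A0\<close> is nonzero.
      Requiring \<open>A1\<close> to vanish there keeps it from being a multiple of
      \<open>A0\<close>.\<close>
    define E :: "'a^2^2" where "E = (\<chi> i j. if i = p \<and> j = q then 1 else 0)"
    have pE: "pairing E A = A$p$q" for A
    proof -
      have "p = 0 \<or> p = 1" "q = 0 \<or> q = 1" by (rule two_cases)+
      then show ?thesis by (auto simp: pairing_def sum_two E_def)
    qed
    obtain A1 where A1: "A1 \<noteq> 0" and uA1: "pairing (u i) A1 = 0" "pairing (u j) A1 = 0"
        and "pairing E A1 = 0"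
      using common_zero_three[of "u i" "u j" E] .
    then have A1pq: "A1$p$q = 0" by (simp add: pE)
    \<comment> \<open>Adjugate of \<open>A0\<close> times \<open>A1\<close>, that is, \<delta> times
      the quotient of \<open>A1\<close> by \<open>A0\<close>.\<close>
    define M where "M = mat2 (A0$1$1) (- A0$0$1) (- A0$1$0) (A0$0$0) ** A1"
    have M: "A0 ** M = mat \<delta> ** A1"
      by (simp add: two_simps M_def \<delta>_def) algebra
    \<comment> \<open>Unlike \<open>A0\<close>, the matrix \<open>A1\<close> may be seen by
      \<open>u k\<close>. Annihilating \<open>B\<close> and \<open>M ** B\<close> by
      \<open>v k\<close> removes that term anyway; the third condition is the trivial one.\<close>
    obtain B where B: "B \<noteq> 0" and "pairing (v k) B = 0" "pairing (transpose M ** v k) B = 0"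
      using common_zero_three[of "v k" "transpose M ** v k" 0] .
    then have vB: "pairing (v k) B = 0" "pairing (v k) (M ** B) = 0"
      by (simp_all add: pairing_mult_left)
    have D': "trace (A ** B ** C) = (\<Sum>s\<in>R. pairing (u s) A * pairing (v s) B * pairing (w s) C)"
      if "pairing (u i) A = 0" "pairing (u j) A = 0" "pairing (u k) A * pairing (v k) B = 0"
      for A B C
    proof -
      have "trace (A ** B ** C) = (\<Sum>s = 1..7. pairing (u s) A * pairing (v s) B * pairing (w s) C)"
        using D by (simp add: decomposition_def)
      also have "\<dots> = (\<Sum>s\<in>R. pairing (u s) A * pairing (v s) B * pairing (w s) C)"
        by (rule sum.mono_neutral_right) (use that in \<open>auto simp: R_def\<close>)
      finally show ?thesis .
    qed
    have DA0: "trace (A0 ** B ** C) = (\<Sum>s\<in>R. pairing (u s) A0 * pairing (v s) B * pairing (w s) C)"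
      for B C using D'[of A0] uA0 by simp
    have injR: "B = 0" if "\<And>s. s \<in> R \<Longrightarrow> pairing (v s) B = 0" for B
    proof -
      have "trace (A0 ** B ** C) = 0" for C unfolding DA0 using that by simp
      then show ?thesis using regular trace_nondegenerate by blast
    qed
    then obtain s where s: "s \<in> R" "pairing (v s) B \<noteq> 0" using B by blast
    have "finite (R - {s})" "card (R - {s}) \<le> 3" using R s by simp_all
    \<comment> \<open>This \<open>C\<close> isolates the term \<open>s\<close> among the four in
      \<open>R\<close>.\<close>
    then obtain C where C: "C \<noteq> 0" "\<And>t. t \<in> R - {s} \<Longrightarrow> pairing (w t) C = 0"
      using common_zero[of "R - {s}" w] by blast
    have sumC: "(\<Sum>s\<in>R. pairing (u s) A * pairing (v s) B * pairing (w s) C)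
        = pairing (u s) A * pairing (v s) B * pairing (w s) C" for A B
    proof -
      have "(\<Sum>s\<in>R. pairing (u s) A * pairing (v s) B * pairing (w s) C)
          = (\<Sum>s\<in>{s}. pairing (u s) A * pairing (v s) B * pairing (w s) C)"
        by (rule sum.mono_neutral_right) (use R s C in auto)
      then show ?thesis by simp
    qed
    have nz: "pairing (u s) A0 \<noteq> 0" "pairing (w s) C \<noteq> 0"
    proof -
      have "\<not> (\<forall>B. trace (A0 ** B ** C) = 0)"
      proof
        assume "\<forall>B. trace (A0 ** B ** C) = 0"
        then have "trace (C ** A0 ** B) = 0" for B
          using trace_cyclic[of C A0 B] by simp
        then show False using trace_nondegenerate regular C(1) by blast
      qed
      then show "pairing (u s) A0 \<noteq> 0" "pairing (w s) C \<noteq> 0" unfolding DA0 sumC by auto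
    qed
    define d where "d = \<delta> * pairing (u s) A1 / pairing (u s) A0"
    \<comment> \<open>On the kernel of \<open>v k\<close>, the functional \<open>v s\<close> is a
      left eigenvector of multiplication by \<open>M\<close>, with eigenvalue
      \<open>d\<close>.\<close>
    have eig: "pairing (v s) (M ** B') = d * pairing (v s) B'" if "pairing (v k) B' = 0" for B'
    proof -
      have "trace (A0 ** (M ** B') ** C) = \<delta> * trace (A1 ** B' ** C)"
        unfolding matrix_mul_assoc M by (simp add: two_simps) algebra
      then have "pairing (u s) A0 * pairing (v s) (M ** B') = \<delta> * (pairing (u s) A1 * pairing (v s) B')"
        using DA0[of "M ** B'" C] D'[of A1 B' C] uA1 that nz(2) unfolding sumC by simp
      then show ?thesis using nz(1) by (simp add: d_def field_simps)
    qed
    let ?t = "M$0$0 + M$1$1" and ?n = "M$0$0 * M$1$1 - M$0$1 * M$1$0"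
    \<comment> \<open>Cayley-Hamilton. Applying \<open>eig\<close> at \<open>B\<close> and at
      \<open>M ** B\<close> makes \<open>d\<close> a root of the characteristic polynomial of
      \<open>M\<close>.\<close>
    have "M ** (M ** B) = mat ?t ** (M ** B) - mat ?n ** B"
      by (simp add: two_simps) algebra
    then have "pairing (v s) (M ** (M ** B)) = ?t * pairing (v s) (M ** B) - ?n * pairing (v s) B"
      by (simp add: pairing_diff) (simp add: pairing_def two_simps algebra_simps)
    with eig[OF vB(1)] eig[OF vB(2)] s(2) have d: "d * d = ?t * d - ?n" by algebra
    define A where "A = mat \<delta> ** A1 - mat d ** A0"
    have "A = A0 ** (M - mat d)"
      unfolding A_def M[symmetric] by (simp add: two_simps algebra_simps)
    then have "A$0$0 * A$1$1 = A$0$1 * A$1$0"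
      using d by (simp add: two_simps) algebra
    moreover have "A \<noteq> 0"
    proof
      assume "A = 0"
      have "p = 0 \<or> p = 1" by (rule two_cases)
      then have "A$p$q = \<delta> * A1$p$q - d * A0$p$q"
        by (auto simp: A_def two_simps)
      with \<open>A = 0\<close> A1pq pq have "d = 0" by simp
      with \<open>A = 0\<close> have "\<forall>p q. \<delta> * A1$p$q = 0" by (auto simp: A_def vec_eq_iff two_simps all_two)
      with \<delta> A1 show False by (simp add: vec_eq_iff)
    qed
    ultimately obtain x a where xa: "A = rank_one x a" using rank_one_of_singular by blast
    with \<open>A \<noteq> 0\<close> have "x \<noteq> 0" "a \<noteq> 0" by (auto simp: rank_one_eq_0)
    moreover have "pairing (u r) A = \<delta> * pairing (u r) A1 - d * pairing (u r) A0" for r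
      unfolding A_def pairing_diff by (simp add: pairing_def two_simps algebra_simps)
    then have u0: "form (u i) x a = 0" "form (u j) x a = 0"
      using uA1 uA0 by (simp_all add: form_def xa[symmetric])
    then have sub: "support u x a \<subseteq> {1..7} - {i, j}" by (auto simp: support_def)
    have c5: "card ({1..7} - {i, j}) = 5" using ij by (simp add: card_Diff_subset)
    \<comment> \<open>All five remaining indices can survive, but then the support contains
      \<open>R\<close>, whose \<open>v s\<close> have only the zero matrix in common.\<close>
    have "card (support u x a) \<le> 4 \<or> card (support u x a) = 5 \<and>
        (\<forall>B. (\<forall>s\<in>support u x a. pairing (v s) B = 0) \<longrightarrow> B = 0)"
    proof (cases "support u x a = {1..7} - {i, j}")
      case True
      then have "R \<subseteq> support u x a" by (auto simp: R_def)
      then have "\<forall>B. (\<forall>s\<in>support u x a. pairing (v s) B = 0) \<longrightarrow> B = 0" using injR by blast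
      with c5 True show ?thesis by simp
    next
      case False
      then have "card (support u x a) < card ({1..7} - {i, j})"
        using sub by (intro psubset_card_mono) auto
      with c5 show ?thesis by simp
    qed
    ultimately show ?thesis using that u0 by blast
  qed
qed

text \<open>Cramer's rule in the plane: a form that vanishes at two independent left vectors
  vanishes at every left vector.\<close>

lemma form_combination_left:
  "bracket x x' * form U y b = bracket y x' * form U x b + bracket x y * form U x' b"
  by (simp add: form_expand bracket_def algebra_simps)

section \<open>Uniqueness, propagation and existence of pair points\<close>

lemma pair_point_in_range: "pair_point u s t x a \<Longrightarrow> s \<in> {1..7} \<and> t \<in> {1..7} \<and> s \<noteq> t"
  using support_subset[of u x a] by (simp add: pair_point_def)

lemma pair_point_vanish:
  assumes "decomposition u v w" "pair_point u s t x a"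
  shows "form (v s) a b = 0" "form (v t) a b = 0" "form (w s) z x = 0" "form (w t) z x = 0"
    "\<exists>y b. form (v s) y b \<noteq> 0" "\<exists>z c. form (w s) z c \<noteq> 0"
  using support_pair[OF assms(1), of x a s t] support_pair[OF assms(1), of x a t s] assms(2)
  by (auto simp: pair_point_def insert_commute)

lemma support_scale:
  assumes "k \<noteq> 0" "l \<noteq> 0"
  shows "support u (k *s x) (l *s a) = support u x a"
  using assms by (auto simp: support_def form_scale_left form_scale_right)

text \<open>The kernels of \<open>v s\<close> and \<open>w s\<close> determine \<open>a\<close> and
  \<open>x\<close> up to scalars, so an index lies on essentially one pair point of
  \<open>u\<close>.\<close>

lemma pair_point_partner:
  assumes D: "decomposition u v w" and "pair_point u s t x a" "pair_point u s t' x' a'"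
  shows "t = t'"
proof -
  have D2: "decomposition v w u" using D by (rule decomposition_cycle)
  note V = pair_point_vanish[OF D assms(2)] and V' = pair_point_vanish[OF D assms(3)]
  have nz: "x \<noteq> 0" "a \<noteq> 0" "x' \<noteq> 0" "a' \<noteq> 0" using assms(2,3) by (auto simp: pair_point_def)
  have "bracket a a' = 0"
    using form_combination_left[of a a' "v s"] V(1,5) V'(1) by (metis add_0 mult_eq_0_iff mult_zero_right)
  then obtain k where k: "a = k *s a'" using bracket_eq_0 nz by blast
  have "bracket x x' * form (w s) z c = 0" for z c
  proof -
    have "bracket x x' * form (w s) z c = bracket c x' * form (w s) z x + bracket x c * form (w s) z x'"
      by (simp add: form_expand bracket_def algebra_simps)
    then show ?thesis using V(3) V'(3) by simp
  qed
  then have "bracket x x' = 0" using V(6) by auto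
  then obtain l where l: "x = l *s x'" using bracket_eq_0 nz by blast
  have "k \<noteq> 0" "l \<noteq> 0" using k l nz by (auto simp: vec2_eq_iff)
  then have "support u x a = support u x' a'" unfolding k l by (intro support_scale)
  then have "{s, t} = {s, t'}" using assms(2,3) by (simp add: pair_point_def)
  then show ?thesis by (auto simp: doubleton_eq_iff)
qed

text \<open>
  The five forms \<open>u s\<close> with \<open>s \<notin> {i, j}\<close> restrict to nonzero linear forms \<open>x \<mapsto> form (u s) x y\<close>
  on a plane.  The bounds on supports only allow classes of 1 or 3 proportional forms, and a
  class of size 1 yields a pair point of \<open>w\<close> through \<open>i\<close> or \<open>j\<close>, so the classes have sizes 1, 1, 3.
\<close>

lemma pair_point_propagate:
  assumes D: "decomposition u v w" and ij: "pair_point v i j y b"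
  shows "\<exists>k l x z1 x1 z2 x2. k \<notin> {i, j} \<and> l \<notin> {i, j} \<and> pair_point u k l x y
    \<and> pair_point w i k z1 x1 \<and> pair_point w j l z2 x2"
proof -
  have D2: "decomposition v w u" using D by (rule decomposition_cycle)
  have D3: "decomposition w u v" using D2 by (rule decomposition_cycle)
  have ij7: "i \<in> {1..7}" "j \<in> {1..7}" "i \<noteq> j" using pair_point_in_range[OF ij] by auto
  have y: "y \<noteq> 0" using ij by (simp add: pair_point_def)
  have uij: "form (u i) x y = 0" "form (u j) x y = 0" for x
    using pair_point_vanish[OF D2 ij] by auto
  define P where "P = {1..7} - {i, j}"
  have P: "finite P" "card P = 5" using ij7 by (auto simp: P_def card_Diff_subset)
  \<comment> \<open>At most two \<open>u\<close>'s vanish on all \<open>rank_one x y\<close>, and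
    \<open>u i\<close>, \<open>u j\<close> already do.\<close>
  have uP: "\<exists>x. form (u s) x y \<noteq> 0" if "s \<in> P" for s
    using exists_not_right_vanishing[OF D y, of "{i, j, s}"] uij ij7 that by (auto simp: P_def)
  have "\<exists>x. x \<noteq> 0 \<and> form (u s) x y = 0" for s by (metis form_kernel_left)
  then obtain X where X: "\<And>s. X s \<noteq> 0" "\<And>s. form (u s) (X s) y = 0" by metis
  define N where "N s = support u (X s) y" for s
  have N_iff: "r \<in> N s \<longleftrightarrow> form (u r) (X s) y \<noteq> 0" if "r \<in> P" for r s
    using that by (auto simp: N_def support_def P_def)
  have NP: "N s \<subseteq> P - {s}" for s
    using uij X(2) by (auto simp: N_def support_def P_def)
  have cardN: "card (N s) = 2 \<or> card (N s) = 4 \<and> N s = P - {s}" if s: "s \<in> P" for s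
  proof -
    have "card (N s) \<le> card (P - {s})" using NP P by (intro card_mono) auto
    then have "card (N s) \<le> 4" using P s by simp
    moreover have "2 \<le> card (N s)" "card (N s) \<noteq> 3"
      unfolding N_def using card_support_ge_2[OF D X(1) y] card_support_neq_3[OF D X(1) y] by blast+
    ultimately have "card (N s) = 2 \<or> card (N s) = 4" by linarith
    moreover have "N s = P - {s}" if "card (N s) = 4"
      using NP P s that by (intro card_subset_eq) auto
    ultimately show ?thesis by blast
  qed
  \<comment> \<open>A form \<open>m\<close> missing from both supports vanishes at
    \<open>X s\<close> and \<open>X t\<close>, which are therefore proportional.\<close>
  have parallel: "r \<in> N s \<longleftrightarrow> r \<in> N t"
    if m: "m \<in> P" "m \<notin> N s" "m \<notin> N t" and r: "r \<in> P" for m r s t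
  proof -
    have "form (u m) (X s) y = 0" "form (u m) (X t) y = 0" using m N_iff by auto
    then have "bracket (X s) (X t) * form (u m) x y = 0" for x
      using form_combination_left[of "X s" "X t" "u m" x y] by simp
    then have "bracket (X s) (X t) = 0" using uP[OF m(1)] by auto
    then obtain k where k: "X s = k *s X t" using bracket_eq_0 X(1) by blast
    with X(1)[of s] have "k \<noteq> 0" by (auto simp: vec2_eq_iff)
    then show ?thesis using r by (simp add: N_iff k form_scale_left)
  qed
  \<comment> \<open>The indices whose form is proportional to no other one in
    \<open>P\<close>.\<close>
  define Q where "Q = {s \<in> P. card (N s) = 4}"
  have QP: "Q \<subseteq> P" by (auto simp: Q_def)
  have NQ: "N s = P - {s}" if "s \<in> Q" for s using cardN[of s] that by (simp add: Q_def)
  have "\<exists>e z. e \<in> {i, j} \<and> pair_point w e s z (X s)" if s: "s \<in> Q" for s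
  proof -
    have "card (support u (X s) y) = 4" using s by (simp add: Q_def N_def)
    then obtain z p q where pq: "pair_point w p q z (X s)" "{p, q} \<subseteq> {1..7} - N s"
      using dual_pair_point[OF D X(1) y] unfolding N_def by metis
    have sub: "{p, q} \<subseteq> {i, j, s}" using pq(2) NQ[OF s] by (auto simp: P_def)
    \<comment> \<open>Otherwise every surviving term would contain \<open>u i\<close> or
      \<open>u j\<close> on a matrix \<open>rank_one x' y\<close>, hence be zero, while the brackets
      are not.\<close>
    have "\<not> {p, q} \<subseteq> {i, j}"
    proof
      assume "{p, q} \<subseteq> {i, j}"
      then have zero: "form (u r) x y = 0" if "r \<in> {p, q}" for r x using uij that by blast
      have N': "support w z (X s) = {p, q}" "z \<noteq> 0" using pq(1) by (auto simp: pair_point_def)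
      obtain x' where x': "bracket (X s) x' \<noteq> 0" using bracket_right X(1) by blast
      obtain y' where y': "bracket y y' \<noteq> 0" using bracket_right y by blast
      obtain b' where b': "bracket b' z \<noteq> 0" using bracket_left N'(2) by blast
      have "bracket (X s) x' * bracket y y' * bracket b' z = 0"
        unfolding decomposition_support_form[OF D3, symmetric] N' using zero by simp
      with x' y' b' show False by simp
    qed
    with sub consider "p = s" "q \<in> {i, j}" | "q = s" "p \<in> {i, j}"
      using pair_point_in_range[OF pq(1)] by auto
    then show ?thesis
      using pq(1) pair_point_swap by cases blast+
  qed
  then obtain e Z where e: "\<And>s. s \<in> Q \<Longrightarrow> e s \<in> {i, j}"
      "\<And>s. s \<in> Q \<Longrightarrow> pair_point w (e s) s (Z s) (X s)" by metis
  \<comment> \<open>Two pair points of \<open>w\<close> through the same index would make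
    \<open>X s\<close> and \<open>X s'\<close> proportional, although distinct elements of
    \<open>Q\<close> have independent forms.\<close>
  have "inj_on e Q"
  proof (rule inj_onI, rule ccontr)
    fix s s' assume s: "s \<in> Q" "s' \<in> Q" "e s = e s'" "s \<noteq> s'"
    note V = pair_point_vanish[OF D3 e(2)[OF s(1)]] and V' = pair_point_vanish[OF D3 e(2)[OF s(2)]]
    have "bracket (X s) (X s') = 0"
      using form_combination_left[of "X s" "X s'" "u (e s)"] V(1,5) V'(1) s(3)
      by (metis add_0 mult_eq_0_iff mult_zero_right)
    then obtain k where k: "X s = k *s X s'" using bracket_eq_0 X(1) by blast
    have "form (u s') (X s) y = 0" unfolding k form_scale_left X(2) by simp
    then have "s' \<notin> N s" using N_iff QP s by blast
    with NQ s QP show False by blast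
  qed
  then have "card Q \<le> card {i, j}" using e(1) by (intro card_inj_on_le) auto
  then have "card Q < card P" using P ij7 by simp
  then have "Q \<noteq> P" by auto
  then obtain t where t: "t \<in> P" "t \<notin> Q" using QP by blast
  then have Nt2: "card (N t) = 2" using cardN by (auto simp: Q_def)
  \<comment> \<open>Two supports of size two cannot cover the five elements of \<open>P\<close>. If
    \<open>r\<close> were outside \<open>Q\<close>, an uncovered index would make the supports of
    \<open>r\<close> and \<open>t\<close> agree, but \<open>r\<close> is only in the latter.\<close>
  have NtQ: "r \<in> Q" if r: "r \<in> N t" for r
  proof (rule ccontr)
    assume "r \<notin> Q"
    have rP: "r \<in> P" using NP r by blast
    with \<open>r \<notin> Q\<close> cardN have "card (N r) = 2" by (auto simp: Q_def)
    then have "card (N r \<union> N t) \<le> 4" using card_Un_le[of "N r" "N t"] Nt2 by simp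
    then have "N r \<union> N t \<noteq> P" using P by auto
    moreover have "N r \<union> N t \<subseteq> P" using NP by blast
    ultimately obtain m where "m \<in> P" "m \<notin> N r" "m \<notin> N t" by blast
    from parallel[OF this rP] r NP show False by blast
  qed
  obtain k l where kl: "N t = {k, l}" "k \<noteq> l" using Nt2 by (auto simp: card_2_iff)
  have pt: "pair_point u k l (X t) y"
    using kl X(1) y by (simp add: pair_point_def N_def)
  have kQ: "k \<in> Q" "l \<in> Q" using NtQ kl by auto
  have "e k \<noteq> e l" using \<open>inj_on e Q\<close> kQ kl(2) by (meson inj_on_contraD)
  then consider "e k = i" "e l = j" | "e k = j" "e l = i" using e(1) kQ by blast
  moreover have "k \<notin> {i, j}" "l \<notin> {i, j}" using kQ QP by (auto simp: P_def)
  ultimately show ?thesis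
    using pt pair_point_swap[OF pt] e(2)[OF kQ(1)] e(2)[OF kQ(2)] by cases blast+
qed

text \<open>A singular common zero of two \<open>u\<close>'s, here the first two, has support of
  size two, or of size four or five with a dual pair point.\<close>

lemma exists_pair_point:
  assumes D: "decomposition u v w"
  shows "(\<exists>s t x a. pair_point u s t x a) \<or> (\<exists>s t x a. pair_point w s t x a)"
proof -
  obtain x a where xa: "x \<noteq> 0" "a \<noteq> 0" and N: "card (support u x a) \<le> 4 \<or> card (support u x a) = 5 \<and>
      (\<forall>B. (\<forall>s\<in>support u x a. pairing (v s) B = 0) \<longrightarrow> B = 0)"
  proof (rule singular_common_zero[OF D])
    show "1 \<in> {1..7::nat}" "2 \<in> {1..7::nat}" "1 \<noteq> (2::nat)" by simp_all
  qed
  show ?thesis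
  proof (cases "card (support u x a) = 2")
    case True
    then show ?thesis using xa by (auto simp: card_2_iff pair_point_def)
  next
    case False
    with card_support_ge_2[OF D xa] card_support_neq_3[OF D xa]
    have "card (support u x a) = 4 \<or> \<not> card (support u x a) \<le> 4" by linarith
    with N have "card (support u x a) = 4 \<or> card (support u x a) = 5 \<and>
      (\<forall>B. (\<forall>s\<in>support u x a. pairing (v s) B = 0) \<longrightarrow> B = 0)" by blast
    then show ?thesis using dual_pair_point[OF D xa] by metis
  qed
qed

section \<open>The configuration of pair points\<close>

text \<open>The graph of pair points grows from one edge: propagation supplies new edges and
  uniqueness of partners closes them up. The labels 2 to 7 match the pairs occurring in Strassen's
  program, whose first product lies on none of them.\<close>

lemma pair_points_complete:
  assumes D: "decomposition u v w" and B: "\<exists>y b. pair_point v i1 i2 y b"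
  shows "\<exists>p x1 x2 x3 a1 a2 a3 y1 y2 y3 b1 b2 b3 z1 z2 z3 c1 c2 c3. inj_on p {2..7::nat}
    \<and> pair_point u (p 5) (p 7) x1 a1 \<and> pair_point u (p 2) (p 6) x2 a2 \<and> pair_point u (p 3) (p 4) x3 a3
    \<and> pair_point v (p 3) (p 6) y1 b1 \<and> pair_point v (p 4) (p 7) y2 b2 \<and> pair_point v (p 2) (p 5) y3 b3
    \<and> pair_point w (p 2) (p 4) z1 c1 \<and> pair_point w (p 3) (p 5) z2 c2 \<and> pair_point w (p 6) (p 7) z3 c3"
proof -
  have D2: "decomposition v w u" using D by (rule decomposition_cycle)
  have D3: "decomposition w u v" using D2 by (rule decomposition_cycle)
  define pu where "pu s t \<longleftrightarrow> (\<exists>x a. pair_point u s t x a)" for s t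
  define pv where "pv s t \<longleftrightarrow> (\<exists>x a. pair_point v s t x a)" for s t
  define pw where "pw s t \<longleftrightarrow> (\<exists>x a. pair_point w s t x a)" for s t
  have swap: "pu s t \<Longrightarrow> pu t s" "pv s t \<Longrightarrow> pv t s" "pw s t \<Longrightarrow> pw t s" for s t
    unfolding pu_def pv_def pw_def by (blast intro: pair_point_swap)+
  have neq: "pu s t \<Longrightarrow> s \<noteq> t" "pv s t \<Longrightarrow> s \<noteq> t" "pw s t \<Longrightarrow> s \<noteq> t" for s t
    by (auto simp: pu_def pv_def pw_def pair_point_def)
  have uniq_u: "t = t'" if "pu s t" "pu s t'" for s t t'
    using that unfolding pu_def by (elim exE) (rule pair_point_partner[OF D])
  have uniq_v: "t = t'" if "pv s t" "pv s t'" for s t t'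
    using that unfolding pv_def by (elim exE) (rule pair_point_partner[OF D2])
  have uniq_w: "t = t'" if "pw s t" "pw s t'" for s t t'
    using that unfolding pw_def by (elim exE) (rule pair_point_partner[OF D3])
  note uniq = uniq_u uniq_v uniq_w
  have V: "\<exists>k l. k \<notin> {i, j} \<and> l \<notin> {i, j} \<and> pu k l \<and> pw i k \<and> pw j l" if "pv i j" for i j
  proof -
    from that obtain y b where "pair_point v i j y b" unfolding pv_def by blast
    from pair_point_propagate[OF D this] show ?thesis unfolding pu_def pw_def by blast
  qed
  have W: "\<exists>k l. k \<notin> {i, j} \<and> l \<notin> {i, j} \<and> pv k l \<and> pu i k \<and> pu j l" if "pw i j" for i j
  proof -
    from that obtain y b where "pair_point w i j y b" unfolding pw_def by blast
    from pair_point_propagate[OF D2 this] show ?thesis unfolding pu_def pv_def by blast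
  qed
  have v12: "pv i1 i2" using B by (simp add: pv_def)
  obtain i3 i4 where 34: "i3 \<notin> {i1, i2}" "i4 \<notin> {i1, i2}" "pu i3 i4" "pw i1 i3" "pw i2 i4"
    using V[OF v12] by blast
  \<comment> \<open>Each propagation returns to a known index: \<open>l\<close> and
    \<open>i4\<close> are both partners of \<open>i3\<close> for \<open>u\<close>, and likewise
    \<open>l'\<close> and \<open>i3\<close> for \<open>i4\<close>.\<close>
  obtain i6 l where 6: "i6 \<notin> {i1, i3}" "pv i6 l" "pu i1 i6" "pu i3 l" using W[OF 34(4)] by blast
  have l: "l = i4" using uniq(1)[OF 6(4) 34(3)] .
  obtain i5 l' where 5: "i5 \<notin> {i2, i4}" "pv i5 l'" "pu i2 i5" "pu i4 l'" using W[OF 34(5)] by blast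
  have l': "l' = i3" using uniq(1)[OF 5(4) swap(1)[OF 34(3)]] .
  have v64: "pv i6 i4" and v53: "pv i5 i3" using 6(2) 5(2) l l' by auto
  have "i6 \<noteq> i2" using uniq(2)[OF swap(2)[OF v12]] v64 34(2) by blast
  moreover have "i5 \<noteq> i1" using uniq(2)[OF v12] v53 34(1) by blast
  moreover have "i5 \<noteq> i6" using uniq(1)[OF swap(1)[OF 5(3)]] swap(1)[OF 6(3)] neq(2)[OF v12] by blast
  ultimately have distinct: "distinct [i6, i2, i5, i4, i1, i3]"
    using neq(2)[OF v12] neq(1)[OF 34(3)] neq(2)[OF v64] neq(2)[OF v53] 34(1,2) 5(1) 6(1) by auto
  \<comment> \<open>Propagating the edge from \<open>i6\<close> to \<open>i4\<close> gives the last
    missing edge, from \<open>i6\<close> to \<open>i5\<close> for \<open>w\<close>.\<close>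
  obtain k m where km: "pu k m" "pw i6 k" "pw i4 m" using V[OF v64] by blast
  have "m = i2" using uniq(3)[OF km(3) swap(3)[OF 34(5)]] .
  then have "k = i5" using uniq(1)[OF swap(1)[OF km(1)]] 5(3) by blast
  then have w65: "pw i6 i5" using km(2) by simp
  define p where "p s = [i6, i2, i5, i4, i1, i3] ! (s - 2)" for s :: nat
  have p: "p 2 = i6" "p 3 = i2" "p 4 = i5" "p 5 = i4" "p 6 = i1" "p 7 = i3"
    by (simp_all add: p_def)
  have "inj_on p {2..7}"
  proof (rule inj_onI)
    fix s t :: nat assume "s \<in> {2..7}" "t \<in> {2..7}" "p s = p t"
    then have "s - 2 = t - 2" unfolding p_def by (subst (asm) nth_eq_iff_index_eq[OF distinct]) auto
    with \<open>s \<in> {2..7}\<close> \<open>t \<in> {2..7}\<close> show "s = t" by auto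
  qed
  moreover have "pu (p 5) (p 7)" "pu (p 2) (p 6)" "pu (p 3) (p 4)" "pv (p 3) (p 6)" "pv (p 4) (p 7)"
    "pv (p 2) (p 5)" "pw (p 2) (p 4)" "pw (p 3) (p 5)" "pw (p 6) (p 7)"
    unfolding p using 34 6(3) 5(3) v12 v64 v53 w65 swap by blast+
  ultimately show ?thesis unfolding pu_def pv_def pw_def by metis
qed

text \<open>Only the common index \<open>s\<close> survives at both points, so one term carries the
  whole trace.\<close>

lemma pair_points_meet:
  assumes D: "decomposition u v w" and "pair_point u s t x a" "pair_point v s r y b" "t \<noteq> r"
  shows "form (u s) x a * form (v s) y b * form (w s) z c = bracket a y * bracket b z * bracket c x"
proof -
  have N: "support u x a = {s, t}" "s \<noteq> t" using assms(2) by (auto simp: pair_point_def)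
  have "t \<in> {1..7}" "t \<notin> support v y b"
    using pair_point_in_range[OF assms(2)] assms(3,4) by (auto simp: pair_point_def)
  then have "form (v t) y b = 0" by (simp add: support_def)
  with decomposition_support_form[OF D, of x a y b z c] N show ?thesis by simp
qed

lemma pair_points_meet_bracket:
  assumes D: "decomposition u v w" and A: "pair_point u s t x a" and B: "pair_point v s r y b"
    and tr: "t \<noteq> r"
  shows "bracket a y \<noteq> 0"
proof
  assume "bracket a y = 0"
  then have 0: "form (u s) x a * form (v s) y b * form (w s) z c = 0" for z c
    using pair_points_meet[OF D A B tr] by simp
  have "s \<in> support u x a" "s \<in> support v y b" using A B by (auto simp: pair_point_def)
  then have "form (u s) x a \<noteq> 0" "form (v s) y b \<noteq> 0" by (auto simp: support_def)
  with 0 pair_point_vanish(6)[OF D A] show False by auto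
qed

text \<open>No term survives at both points, so the product of brackets vanishes for all
  \<open>z\<close> and \<open>c\<close>.\<close>

lemma pair_points_disjoint_bracket:
  assumes D: "decomposition u v w" and A: "pair_point u s t x a" and B: "pair_point v s' t' y b"
    and disj: "s \<noteq> s'" "s \<noteq> t'" "t \<noteq> s'" "t \<noteq> t'"
  shows "bracket a y = 0"
proof -
  have N: "support u x a = {s, t}" "s \<noteq> t" "support v y b = {s', t'}" "b \<noteq> 0" "x \<noteq> 0"
    using A B by (auto simp: pair_point_def)
  have "s \<notin> support v y b" "t \<notin> support v y b" using N disj by auto
  then have "form (v s) y b = 0" "form (v t) y b = 0"
    using pair_point_in_range[OF A] by (auto simp: support_def)
  then have 0: "bracket a y * bracket b z * bracket c x = 0" for z c
    using decomposition_support_form[OF D, of x a y b z c] N by simp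
  obtain z where "bracket b z \<noteq> 0" using bracket_right N(4) by blast
  moreover obtain c where "bracket c x \<noteq> 0" using bracket_left N(5) by blast
  ultimately show ?thesis using 0[of z c] by simp
qed

lemma pair_point_scale:
  assumes "pair_point u s t x a" "x = k *s x'" "a = l *s a'"
  shows "pair_point u s t x' a'"
proof -
  have "k \<noteq> 0" "l \<noteq> 0" "x' \<noteq> 0" "a' \<noteq> 0" using assms by (auto simp: pair_point_def vec2_eq_iff)
  with assms(1) show ?thesis unfolding assms(2,3) by (simp add: pair_point_def support_scale)
qed

text \<open>All \<open>rank_one x q\<close> and \<open>rank_one p a\<close> together span a space of
  dimension three, so the forms vanishing on it lie on one line. The ratio of two of them is
  expressed by cross-multiplication.\<close>

lemma form_proportional:
  assumes pq: "p \<noteq> 0" "q \<noteq> 0"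
    and U: "\<And>x. form U x q = 0" "\<And>a. form U p a = 0"
    and U': "\<And>x. form U' x q = 0" "\<And>a. form U' p a = 0"
  shows "pairing U A * form U' x a = form U x a * pairing U' A"
proof -
  have rank: "\<exists>k. U$0$0 = k * (p$1 * q$0) \<and> U$0$1 = k * (p$1 * q$1)
      \<and> U$1$0 = - k * (p$0 * q$0) \<and> U$1$1 = - k * (p$0 * q$1)"
    if U: "\<And>x. form U x q = 0" "\<And>a. form U p a = 0" for U
  proof -
    have e: "U$0$1 * q$0 = U$0$0 * q$1" "U$1$1 * q$0 = U$1$0 * q$1"
      "p$0 * U$0$0 = - (p$1 * U$1$0)" "p$0 * U$0$1 = - (p$1 * U$1$1)"
      using U(1)[of "vec2 1 0"] U(1)[of "vec2 0 1"] U(2)[of "vec2 1 0"] U(2)[of "vec2 0 1"]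
      by (simp_all add: form_expand eq_neg_iff_add_eq_0 algebra_simps)
    have "p$0 \<noteq> 0 \<or> p$1 \<noteq> 0" "q$0 \<noteq> 0 \<or> q$1 \<noteq> 0" using pq by (auto simp: vec2_eq_iff)
    then consider "p$1 \<noteq> 0" "q$0 \<noteq> 0" | "p$1 \<noteq> 0" "q$1 \<noteq> 0" | "p$0 \<noteq> 0" "q$0 \<noteq> 0"
      | "p$0 \<noteq> 0" "q$1 \<noteq> 0" by blast
    \<comment> \<open>The factor is read off at whichever entry of the spanning matrix is
      nonzero.\<close>
    then obtain k where "k * (p$1 * q$0) = U$0$0 \<and> p$1 * q$0 \<noteq> 0 \<or> k * (p$1 * q$1) = U$0$1 \<and> p$1 * q$1 \<noteq> 0
        \<or> - k * (p$0 * q$0) = U$1$0 \<and> p$0 * q$0 \<noteq> 0 \<or> - k * (p$0 * q$1) = U$1$1 \<and> p$0 * q$1 \<noteq> 0"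
    proof cases
      case 1
      then show ?thesis by (intro that[of "U$0$0 / (p$1 * q$0)"]) simp
    next
      case 2
      then show ?thesis by (intro that[of "U$0$1 / (p$1 * q$1)"]) simp
    next
      case 3
      then show ?thesis by (intro that[of "- U$1$0 / (p$0 * q$0)"]) simp
    next
      case 4
      then show ?thesis by (intro that[of "- U$1$1 / (p$0 * q$1)"]) simp
    qed
    with e have "U$0$0 = k * (p$1 * q$0)" "U$0$1 = k * (p$1 * q$1)"
        "U$1$0 = - k * (p$0 * q$0)" "U$1$1 = - k * (p$0 * q$1)"
      unfolding mult_eq_0_iff de_Morgan_disj by (elim disjE conjE; algebra)+
    then show ?thesis by blast
  qed
  obtain k where "U$0$0 = k * (p$1 * q$0)" "U$0$1 = k * (p$1 * q$1)"
      "U$1$0 = - k * (p$0 * q$0)" "U$1$1 = - k * (p$0 * q$1)" using rank[OF U] by blast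
  moreover obtain k' where "U'$0$0 = k' * (p$1 * q$0)" "U'$0$1 = k' * (p$1 * q$1)"
      "U'$1$0 = - k' * (p$0 * q$0)" "U'$1$1 = - k' * (p$0 * q$1)" using rank[OF U'] by blast
  ultimately show ?thesis by (simp add: pairing_def form_expand sum_two algebra_simps)
qed

text \<open>The vectors of the three points prescribe the kernels of all three forms, so each form
  is known up to a scalar. The product of the scalars is fixed because both terms take the same
  bracket value at the points.\<close>

lemma term_unique:
  assumes D: "decomposition u v w"
    and P: "pair_point u s t x a" "pair_point v s r y b" "pair_point w s q z c" "t \<noteq> r"
    and D': "decomposition u' v' w'"
    and P': "pair_point u' s' t' x a" "pair_point v' s' r' y b" "pair_point w' s' q' z c" "t' \<noteq> r'"
  shows "pairing (u s) A * pairing (v s) B * pairing (w s) C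
    = pairing (u' s') A * pairing (v' s') B * pairing (w' s') C"
proof -
  have D2: "decomposition v w u" "decomposition v' w' u'" using D D' by (auto dest: decomposition_cycle)
  have D3: "decomposition w u v" "decomposition w' u' v'" using D2 by (auto dest: decomposition_cycle)
  note V = pair_point_vanish(1,3)[OF D P(1)] pair_point_vanish(1,3)[OF D2(1) P(2)]
    pair_point_vanish(1,3)[OF D3(1) P(3)]
  note V' = pair_point_vanish(1,3)[OF D' P'(1)] pair_point_vanish(1,3)[OF D2(2) P'(2)]
    pair_point_vanish(1,3)[OF D3(2) P'(3)]
  have nz: "x \<noteq> 0" "a \<noteq> 0" "y \<noteq> 0" "b \<noteq> 0" "z \<noteq> 0" "c \<noteq> 0"
    using P by (auto simp: pair_point_def)
  have u: "pairing (u s) A * form (u' s') x a = form (u s) x a * pairing (u' s') A"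
    by (rule form_proportional[of c y]) (use V V' nz in auto)
  have v: "pairing (v s) B * form (v' s') y b = form (v s) y b * pairing (v' s') B"
    by (rule form_proportional[of a z]) (use V V' nz in auto)
  have w: "pairing (w s) C * form (w' s') z c = form (w s) z c * pairing (w' s') C"
    by (rule form_proportional[of b x]) (use V V' nz in auto)
  have "s' \<in> support u' x a" "s' \<in> support v' y b" "s' \<in> support w' z c"
    using P' by (auto simp: pair_point_def)
  then have f': "form (u' s') x a * form (v' s') y b * form (w' s') z c \<noteq> 0"
    by (auto simp: support_def)
  have f: "form (u s) x a * form (v s) y b * form (w s) z c
      = form (u' s') x a * form (v' s') y b * form (w' s') z c"
    using pair_points_meet[OF D P(1,2,4)] pair_points_meet[OF D' P'(1,2,4)] by simp
  have "pairing (u s) A * pairing (v s) B * pairing (w s) C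
        * (form (u' s') x a * form (v' s') y b * form (w' s') z c)
      = (pairing (u s) A * form (u' s') x a) * (pairing (v s) B * form (v' s') y b)
        * (pairing (w s) C * form (w' s') z c)"
    by (simp add: mult_ac)
  also have "\<dots> = pairing (u' s') A * pairing (v' s') B * pairing (w' s') C
      * (form (u s) x a * form (v s) y b * form (w s) z c)"
    unfolding u v w by (simp add: mult_ac)
  finally show ?thesis unfolding f using f' by simp
qed

lemma bracket_scale: "bracket (k *s x) (l *s y) = k * l * bracket x y"
  by (simp add: bracket_def algebra_simps)

text \<open>Pairwise independent vectors of a plane form a projective frame: multiples of the first
  two add up to the third. The factor 1 gives the third the shape used by
  \<open>pair_point_scale\<close>.\<close>

lemma independent_rescale:
  assumes "bracket x1 x2 \<noteq> 0" "bracket x1 x3 \<noteq> 0" "bracket x3 x2 \<noteq> 0"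
  obtains k l x1' x2' where "x1 = k *s x1'" "x2 = l *s x2'" "x3 = 1 *s (x1' + x2')" "bracket x1' x2' \<noteq> 0"
proof -
  let ?k = "bracket x3 x2 / bracket x1 x2" and ?l = "bracket x1 x3 / bracket x1 x2"
  have nz: "?k \<noteq> 0" "?l \<noteq> 0" using assms by auto
  show ?thesis
  proof (rule that)
    show "x1 = inverse ?k *s (?k *s x1)" "x2 = inverse ?l *s (?l *s x2)"
      using nz by (simp_all add: vector_smult_assoc)
    have "bracket x1 x2 * x3$i = bracket x3 x2 * x1$i + bracket x1 x3 * x2$i" for i
      using two_cases[of i] by (auto simp: bracket_def algebra_simps)
    then have "x3$i = ?k * x1$i + ?l * x2$i" for i
      using assms(1) by (simp add: field_simps)
    then show "x3 = 1 *s (?k *s x1 + ?l *s x2)" by (simp add: vec_eq_iff)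
    show "bracket (?k *s x1) (?l *s x2) \<noteq> 0" unfolding bracket_scale using nz assms(1) by simp
  qed
qed

text \<open>Disjoint pairs force vectors of cyclically consecutive factors onto common lines,
  leaving three triples of lines. Pairs that meet make the lines in each triple distinct, so each
  triple can be rescaled to a frame.\<close>

lemma decomposition_normal_points:
  assumes D: "decomposition u v w"
  shows "\<exists>p x1 x2 y1 y2 z1 z2. inj_on p {2..7::nat}
    \<and> bracket x1 x2 \<noteq> 0 \<and> bracket y1 y2 \<noteq> 0 \<and> bracket z1 z2 \<noteq> 0
    \<and> pair_point u (p 5) (p 7) x1 y1 \<and> pair_point u (p 2) (p 6) x2 y2
    \<and> pair_point u (p 3) (p 4) (x1 + x2) (y1 + y2)
    \<and> pair_point v (p 3) (p 6) y1 z1 \<and> pair_point v (p 4) (p 7) y2 z2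
    \<and> pair_point v (p 2) (p 5) (y1 + y2) (z1 + z2)
    \<and> pair_point w (p 2) (p 4) z1 x1 \<and> pair_point w (p 3) (p 5) z2 x2
    \<and> pair_point w (p 6) (p 7) (z1 + z2) (x1 + x2)"
proof -
  have D2: "decomposition v w u" using D by (rule decomposition_cycle)
  have D3: "decomposition w u v" using D2 by (rule decomposition_cycle)
  \<comment> \<open>If only a pair point of \<open>u\<close> is at hand, the completed configuration
    of the rotated decomposition contains one of \<open>v\<close>.\<close>
  have "\<exists>s t y b. pair_point v s t y b"
    using exists_pair_point[OF D2]
  proof
    assume "\<exists>s t x a. pair_point u s t x a"
    then obtain s t where "\<exists>x a. pair_point u s t x a" by blast
    from pair_points_complete[OF D3 this] show ?thesis by blast
  qed
  then obtain s t where "\<exists>y b. pair_point v s t y b" by blast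
  from pair_points_complete[OF D this]
  obtain p x1 x2 x3 a1 a2 a3 y1 y2 y3 b1 b2 b3 z1 z2 z3 c1 c2 c3
    where inj: "inj_on p {2..7::nat}"
    and A: "pair_point u (p 5) (p 7) x1 a1" "pair_point u (p 2) (p 6) x2 a2" "pair_point u (p 3) (p 4) x3 a3"
    and B: "pair_point v (p 3) (p 6) y1 b1" "pair_point v (p 4) (p 7) y2 b2" "pair_point v (p 2) (p 5) y3 b3"
    and C: "pair_point w (p 2) (p 4) z1 c1" "pair_point w (p 3) (p 5) z2 c2" "pair_point w (p 6) (p 7) z3 c3"
    by (elim exE conjE)
  have ne: "p i \<noteq> p j" if "i \<noteq> j" "2 \<le> i" "i \<le> 7" "2 \<le> j" "j \<le> 7" for i j
    using inj_onD[OF inj] that by auto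
  have align: "pair_point f s t x a'"
    if P: "pair_point f s t x a" and 0: "bracket a a' = 0" and P': "pair_point f' s' t' a' b"
    for f f' :: "nat \<Rightarrow> 'a^2^2" and s t s' t' x a a' b
  proof -
    obtain k where "a = k *s a'"
      using bracket_eq_0[OF 0] P' by (auto simp: pair_point_def)
    then show ?thesis by (intro pair_point_scale[OF P, of 1 x k]) simp_all
  qed
  have A: "pair_point u (p 5) (p 7) x1 y1" "pair_point u (p 2) (p 6) x2 y2" "pair_point u (p 3) (p 4) x3 y3"
    by (rule align[OF A(1) _ B(1)] align[OF A(2) _ B(2)] align[OF A(3) _ B(3)],
      rule pair_points_disjoint_bracket[OF D A(1) B(1)] pair_points_disjoint_bracket[OF D A(2) B(2)]
        pair_points_disjoint_bracket[OF D A(3) B(3)]; rule ne; simp)+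
  have B: "pair_point v (p 3) (p 6) y1 z1" "pair_point v (p 4) (p 7) y2 z2" "pair_point v (p 2) (p 5) y3 z3"
    by (rule align[OF B(1) _ C(1)] align[OF B(2) _ C(2)] align[OF B(3) _ C(3)],
      rule pair_points_disjoint_bracket[OF D2 B(1) C(1)] pair_points_disjoint_bracket[OF D2 B(2) C(2)]
        pair_points_disjoint_bracket[OF D2 B(3) C(3)]; rule ne; simp)+
  have C: "pair_point w (p 2) (p 4) z1 x1" "pair_point w (p 3) (p 5) z2 x2" "pair_point w (p 6) (p 7) z3 x3"
    by (rule align[OF C(1) _ A(1)] align[OF C(2) _ A(2)] align[OF C(3) _ A(3)],
      rule pair_points_disjoint_bracket[OF D3 C(1) A(1)] pair_points_disjoint_bracket[OF D3 C(2) A(2)]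
        pair_points_disjoint_bracket[OF D3 C(3) A(3)]; rule ne; simp)+
  note sA = A[THEN pair_point_swap] and sB = B[THEN pair_point_swap] and sC = C[THEN pair_point_swap]
  have "bracket y1 y2 \<noteq> 0"
    by (rule pair_points_meet_bracket[OF D sA(1) sB(2)]) (rule ne; simp)
  moreover have "bracket y1 y3 \<noteq> 0"
    by (rule pair_points_meet_bracket[OF D A(1) sB(3)]) (rule ne; simp)
  moreover have "bracket y3 y2 \<noteq> 0"
    by (rule pair_points_meet_bracket[OF D sA(3) B(2)]) (rule ne; simp)
  ultimately obtain ky ly y1' y2' where y: "y1 = ky *s y1'" "y2 = ly *s y2'" "y3 = 1 *s (y1' + y2')"
    and y': "bracket y1' y2' \<noteq> 0" by (rule independent_rescale)
  have "bracket z1 z2 \<noteq> 0"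
    by (rule pair_points_meet_bracket[OF D2 B(1) C(2)]) (rule ne; simp)
  moreover have "bracket z1 z3 \<noteq> 0"
    by (rule pair_points_meet_bracket[OF D2 sB(1) C(3)]) (rule ne; simp)
  moreover have "bracket z3 z2 \<noteq> 0"
    by (rule pair_points_meet_bracket[OF D2 sB(3) sC(2)]) (rule ne; simp)
  ultimately obtain kz lz z1' z2' where z: "z1 = kz *s z1'" "z2 = lz *s z2'" "z3 = 1 *s (z1' + z2')"
    and z': "bracket z1' z2' \<noteq> 0" by (rule independent_rescale)
  have "bracket x1 x2 \<noteq> 0"
    by (rule pair_points_meet_bracket[OF D3 C(1) A(2)]) (rule ne; simp)
  moreover have "bracket x1 x3 \<noteq> 0"
    by (rule pair_points_meet_bracket[OF D3 sC(1) sA(3)]) (rule ne; simp)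
  moreover have "bracket x3 x2 \<noteq> 0"
    by (rule pair_points_meet_bracket[OF D3 C(3) sA(2)]) (rule ne; simp)
  ultimately obtain kx lx x1' x2' where x: "x1 = kx *s x1'" "x2 = lx *s x2'" "x3 = 1 *s (x1' + x2')"
    and x': "bracket x1' x2' \<noteq> 0" by (rule independent_rescale)
  show ?thesis
    by (intro exI conjI; (fact inj x' y' z')?)
      (rule pair_point_scale[OF A(1) x(1) y(1)] pair_point_scale[OF A(2) x(2) y(2)]
        pair_point_scale[OF A(3) x(3) y(3)] pair_point_scale[OF B(1) y(1) z(1)]
        pair_point_scale[OF B(2) y(2) z(2)] pair_point_scale[OF B(3) y(3) z(3)]
        pair_point_scale[OF C(1) z(1) x(1)] pair_point_scale[OF C(2) z(2) x(2)]
        pair_point_scale[OF C(3) z(3) x(3)])+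
qed

section \<open>The action of triples of invertible matrices\<close>

definition from_columns :: "'a^2 \<Rightarrow> 'a^2 \<Rightarrow> 'a^2^2" where
  "from_columns x y = mat2 (x$0) (y$0) (x$1) (y$1)"

lemma from_columns_inverse:
  assumes "bracket x y \<noteq> 0"
  obtains M where "from_columns x y ** M = mat 1" "M ** from_columns x y = mat 1"
proof (rule that)
  let ?M = "mat2 (y$1 / bracket x y) (- y$0 / bracket x y) (- x$1 / bracket x y) (x$0 / bracket x y)"
  show "from_columns x y ** ?M = mat 1" "?M ** from_columns x y = mat 1"
    using assms by (simp_all add: two_simps from_columns_def divide_simps) (simp_all add: bracket_def algebra_simps)
qed

lemma from_columns_mult:
  "from_columns x y *v vec2 1 0 = x" "from_columns x y *v vec2 0 1 = y" "from_columns x y *v vec2 1 1 = x + y"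
  for x y :: "'a::field^2"
  by (simp_all add: two_simps from_columns_def)

lemma pairing_sandwich:
  "pairing (transpose P ** U ** transpose Q) A = pairing U (P ** A ** Q)"
  for P U Q A :: "'a::field^2^2"
  by (simp add: pairing_def two_simps algebra_simps)

text \<open>Inside the trace the inserted matrices cancel between neighbours, the outer two after a
  cyclic shift.\<close>

lemma decomposition_gauge:
  assumes D: "decomposition u v w" and inv: "g ** g' = mat 1" "h ** h' = mat 1" "f ** f' = mat 1"
  shows "decomposition (\<lambda>s. transpose g' ** u s ** transpose h)
    (\<lambda>s. transpose h' ** v s ** transpose f) (\<lambda>s. transpose f' ** w s ** transpose g)"
proof -
  have "trace (A ** B ** C) = trace ((g' ** A ** h) ** (h' ** B ** f) ** (f' ** C ** g))" for A B C
  proof -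
    have "(g' ** A ** h) ** (h' ** B ** f) ** (f' ** C ** g)
        = g' ** (A ** (h ** h') ** B ** (f ** f') ** C) ** g"
      by (simp only: matrix_mul_assoc)
    then have "trace ((g' ** A ** h) ** (h' ** B ** f) ** (f' ** C ** g))
        = trace ((A ** B ** C) ** g ** g')"
      unfolding inv by (simp only: matrix_mul_rid trace_cyclic[of g'])
    also have "\<dots> = trace (A ** B ** C)"
      by (simp only: matrix_mul_assoc[symmetric] inv matrix_mul_rid)
    finally show ?thesis by simp
  qed
  then show ?thesis using D by (simp add: decomposition_def pairing_sandwich)
qed

lemma pairing_mat: "pairing U (mat k ** A) = k * pairing U A" for A :: "'a::field^2^2"
  by (simp add: pairing_def two_simps algebra_simps)

text \<open>\<open>bracket\<close> changes by the determinant of \<open>h\<close> under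
  \<open>h\<close>, so every form at the moved point is the old value times the nonzero factor
  \<open>bracket y1 y2\<close>.\<close>

lemma pair_point_gauge:
  assumes P: "pair_point u s t x a" and g: "g' ** g = mat 1" and h: "h = from_columns y1 y2" "bracket y1 y2 \<noteq> 0"
    and nz: "g *v x \<noteq> 0" "h *v a \<noteq> 0"
  shows "pair_point (\<lambda>s. transpose g' ** u s ** transpose h) s t (g *v x) (h *v a)"
proof -
  have "rank_one (g *v x) (h *v a) ** h = mat (bracket y1 y2) ** (g ** rank_one x a)"
    by (simp add: h(1) two_simps rank_one_def from_columns_def bracket_def) algebra
  then have "g' ** rank_one (g *v x) (h *v a) ** h = g' ** (mat (bracket y1 y2) ** (g ** rank_one x a))"
    by (simp only: matrix_mul_assoc[symmetric])
  also have "\<dots> = mat (bracket y1 y2) ** ((g' ** g) ** rank_one x a)"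
    by (simp add: two_simps algebra_simps)
  also have "\<dots> = mat (bracket y1 y2) ** rank_one x a" by (simp only: g matrix_mul_lid)
  finally have "form (transpose g' ** u s ** transpose h) (g *v x) (h *v a)
      = bracket y1 y2 * form (u s) x a" for s
    by (simp only: form_def pairing_sandwich pairing_mat)
  then have "support (\<lambda>s. transpose g' ** u s ** transpose h) (g *v x) (h *v a) = support u x a"
    using h(2) by (simp add: support_def)
  with P nz show ?thesis by (simp add: pair_point_def)
qed

section \<open>Strassen's program\<close>

lemma one_to_seven: "{1..7::nat} = {1, 2, 3, 4, 5, 6, 7}"
  by auto

lemma strassen_coefficients:
  "ucoeff strassen (Suc 0) = mat2 1 0 0 1"
  "ucoeff strassen 2 = mat2 0 0 1 1"
  "ucoeff strassen 3 = mat2 1 0 0 0"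
  "ucoeff strassen 4 = mat2 0 0 0 1"
  "ucoeff strassen 5 = mat2 1 1 0 0"
  "ucoeff strassen 6 = mat2 (-1) 0 1 0"
  "ucoeff strassen 7 = mat2 0 1 0 (-1)"
  "vcoeff strassen (Suc 0) = mat2 1 0 0 1"
  "vcoeff strassen 2 = mat2 1 0 0 0"
  "vcoeff strassen 3 = mat2 0 1 0 (-1)"
  "vcoeff strassen 4 = mat2 (-1) 0 1 0"
  "vcoeff strassen 5 = mat2 0 0 0 1"
  "vcoeff strassen 6 = mat2 1 1 0 0"
  "vcoeff strassen 7 = mat2 0 0 1 1"
  "wcoeff strassen (Suc 0) = mat2 1 0 0 1"
  "wcoeff strassen 2 = mat2 0 0 1 (-1)"
  "wcoeff strassen 3 = mat2 0 1 0 1"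
  "wcoeff strassen 4 = mat2 1 0 1 0"
  "wcoeff strassen 5 = mat2 (-1) 1 0 0"
  "wcoeff strassen 6 = mat2 0 0 0 1"
  "wcoeff strassen 7 = mat2 1 0 0 0"
  by (simp_all add: strassen_def)

lemma pairing_mat2: "pairing (mat2 p q r s) A = p * A$0$0 + q * A$0$1 + r * A$1$0 + s * A$1$1"
  by (simp add: pairing_def sum_two)

lemma transpose_mat2: "transpose (mat2 p q r s) = mat2 p r q s"
  by (simp add: two_simps)

lemma form_mat2: "form (mat2 p q r s) x a = x$0 * (q * a$0 - p * a$1) + x$1 * (s * a$0 - r * a$1)"
  by (simp add: form_expand)

lemma decomposition_strassen:
  "decomposition (ucoeff strassen) (vcoeff strassen) (\<lambda>s. transpose (wcoeff strassen s))"
proof -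
  have "trace (A ** B ** C) = (\<Sum>s = 1..7. pairing (ucoeff strassen s) A * pairing (vcoeff strassen s) B
      * pairing (transpose (wcoeff strassen s)) C)" for A B C :: "'a^2^2"
    unfolding one_to_seven
    by (simp add: strassen_coefficients pairing_mat2 transpose_mat2) (simp add: two_simps, algebra)
  then show ?thesis by (simp add: decomposition_def)
qed

lemma Collect_insert:
  "{s \<in> insert r R. P s} = (if P r then insert r {s \<in> R. P s} else {s \<in> R. P s})"
  by auto

text \<open>In every triple the lines are spanned by the standard vectors and their sum, and the
  pairs follow the pattern of \<open>decomposition_normal_points\<close>.\<close>

lemma strassen_pair_points:
  fixes e0 e1 e2 :: "'a::field_char_0^2"
  defines "e0 \<equiv> vec2 1 0" and "e1 \<equiv> vec2 0 1" and "e2 \<equiv> vec2 1 1"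
  shows "pair_point (ucoeff strassen) 5 7 e0 e0" "pair_point (ucoeff strassen) 2 6 e1 e1"
    "pair_point (ucoeff strassen) 3 4 e2 e2"
    "pair_point (vcoeff strassen) 3 6 e0 e0" "pair_point (vcoeff strassen) 4 7 e1 e1"
    "pair_point (vcoeff strassen) 2 5 e2 e2"
    "pair_point (\<lambda>s. transpose (wcoeff strassen s)) 2 4 e0 e0"
    "pair_point (\<lambda>s. transpose (wcoeff strassen s)) 3 5 e1 e1"
    "pair_point (\<lambda>s. transpose (wcoeff strassen s)) 6 7 e2 e2"
  unfolding e0_def e1_def e2_def pair_point_def support_def one_to_seven Collect_insert
  by (simp_all add: strassen_coefficients form_mat2 transpose_mat2 vec2_eq_iff)


text \<open>Each factor is a sum of squares of integers, not all zero, hence nonzero in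
  characteristic zero.\<close>

lemma strassen_term_nonzero:
  assumes "s \<in> {1..7}"
  shows "pairing (ucoeff strassen s) (ucoeff strassen s :: 'a::field_char_0^2^2)
    * pairing (vcoeff strassen s) (vcoeff strassen s :: 'a^2^2)
    * pairing (transpose (wcoeff strassen s)) (transpose (wcoeff strassen s) :: 'a^2^2) \<noteq> 0"
  using assms unfolding one_to_seven
  by (auto simp: strassen_coefficients pairing_mat2 transpose_mat2)

section \<open>Translation between programs and decompositions\<close>

lemma summand_eq_pairing:
  "summand T s A B l q = wcoeff T s $ l $ q * pairing (ucoeff T s) A * pairing (vcoeff T s) B"
  by (simp add: summand_def pairing_def)

definition matrix_unit :: "2 \<Rightarrow> 2 \<Rightarrow> 'a::field^2^2" where
  "matrix_unit p q = (\<chi> i j. if i = p \<and> j = q then 1 else 0)"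

lemma pairing_matrix_unit: "pairing (transpose W) (matrix_unit q l) = W $ l $ q"
  using two_cases[of q] two_cases[of l] by (auto simp: pairing_def two_simps matrix_unit_def)

lemma trace_matrix_unit: "trace (X ** matrix_unit q l) = X $ l $ q" for X :: "'a::field^2^2"
  using two_cases[of q] two_cases[of l] by (auto simp: two_simps matrix_unit_def)

text \<open>
  The output coefficients are transposed because \<open>trace (X ** C)\<close> pairs the entry \<open>(l, q)\<close> of \<open>X\<close>
  with the entry \<open>(q, l)\<close> of \<open>C\<close>.
\<close>

lemma decomposition_of_elementary_program:
  assumes T: "elementary_program T" and len: "len T \<le> 7"
  shows "decomposition (\<lambda>s. if s \<le> len T then ucoeff T s else 0) (vcoeff T) (\<lambda>s. transpose (wcoeff T s))"
  unfolding decomposition_def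
proof (intro allI)
  fix A B C :: "'a^2^2"
  let ?t = "\<lambda>s. pairing (ucoeff T s) A * pairing (vcoeff T s) B * pairing (transpose (wcoeff T s)) C"
  have "trace (A ** B ** C) = (\<Sum>l\<in>UNIV. \<Sum>q\<in>UNIV. (A ** B) $ l $ q * C $ q $ l)"
    by (simp add: trace_two sum_two matrix_mult_two[of "A ** B" C])
  also have "\<dots> = (\<Sum>s = 1..len T. \<Sum>l\<in>UNIV. \<Sum>q\<in>UNIV. summand T s A B l q * C $ q $ l)"
    using T unfolding elementary_program_def sum_two by (simp add: sum.distrib sum_distrib_right)
  also have "\<dots> = (\<Sum>s = 1..len T. ?t s)"
    by (rule sum.cong) (simp_all add: summand_eq_pairing pairing_def[of "transpose _"] sum_two transpose_nth algebra_simps)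
  also have "\<dots> = (\<Sum>s = 1..len T. pairing (if s \<le> len T then ucoeff T s else 0) A
      * pairing (vcoeff T s) B * pairing (transpose (wcoeff T s)) C)"
    by (rule sum.cong) auto
  \<comment> \<open>Beyond \<open>len T\<close> the arrays hold arbitrary values, so a zero first
    form cancels those terms.\<close>
  also have "\<dots> = (\<Sum>s = 1..7. pairing (if s \<le> len T then ucoeff T s else 0) A
      * pairing (vcoeff T s) B * pairing (transpose (wcoeff T s)) C)"
    using len by (intro sum.mono_neutral_left) (auto simp: pairing_def)
  finally show "trace (A ** B ** C) = \<dots>" .
qed

lemma elementary_program_of_decomposition:
  assumes D: "decomposition (ucoeff T) (vcoeff T) (\<lambda>s. transpose (wcoeff T s))" and len: "len T = 7"
  shows "elementary_program T"
  unfolding elementary_program_def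
proof (intro allI)
  fix A B :: "'a^2^2" and l q
  have "(A ** B) $ l $ q = trace (A ** B ** matrix_unit q l)" by (simp add: trace_matrix_unit)
  also have "\<dots> = (\<Sum>s = 1..len T. summand T s A B l q)"
    using D unfolding decomposition_def len
    by (simp add: pairing_matrix_unit summand_eq_pairing mult_ac)
  finally show "(A ** B) $ l $ q = (\<Sum>s = 1..len T. summand T s A B l q)" .
qed

lemma double_sum_sandwich:
  fixes P M Q :: "'a::field^2^2"
  shows "(\<Sum>\<nu>\<in>UNIV. \<Sum>\<kappa>\<in>UNIV. P $ i $ \<nu> * Q $ \<kappa> $ j * M $ \<nu> $ \<kappa>) = (P ** M ** Q) $ i $ j"
  by (simp add: two_simps algebra_simps)

lemma transpose_sandwich_cancel:
  fixes P M Q :: "'a::field^2^2"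
  assumes "P' ** P = mat 1" "Q' ** Q = mat 1"
  shows "transpose P ** (transpose P' ** M ** transpose Q) ** transpose Q' = M"
proof -
  have "transpose P ** (transpose P' ** M ** transpose Q) ** transpose Q'
      = transpose (P' ** P) ** M ** transpose (Q' ** Q)"
    by (simp only: matrix_transpose_mul matrix_mul_assoc)
  then show ?thesis by (simp add: assms transpose_mat)
qed

section \<open>Comparison of a short program with Strassen's\<close>

theorem theorem3:
  fixes T :: "'a::field_char_0 triple"
  assumes "elementary_program T"
  shows "len T \<le> 7 \<longleftrightarrow>
    (\<exists>T'. define_same_program T T' \<and> equivalent_triples T' strassen)"
proof
  assume "\<exists>T'. define_same_program T T' \<and> equivalent_triples T' strassen"
  then show "len T \<le> 7"
    by (auto simp: define_same_program_def equivalent_triples_def strassen_def)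
next
  assume len: "len T \<le> 7"
  define u where "u = (\<lambda>s. if s \<le> len T then ucoeff T s else 0)"
  define v where "v = vcoeff T"
  define w where "w = (\<lambda>s. transpose (wcoeff T s))"
  have D: "decomposition u v w"
    using decomposition_of_elementary_program[OF assms len] unfolding u_def v_def w_def .
  obtain p x1 x2 y1 y2 z1 z2 where inj: "inj_on p {2..7::nat}"
    and x: "bracket x1 x2 \<noteq> 0" and y: "bracket y1 y2 \<noteq> 0" and z: "bracket z1 z2 \<noteq> 0"
    and A: "pair_point u (p 5) (p 7) x1 y1" "pair_point u (p 2) (p 6) x2 y2"
      "pair_point u (p 3) (p 4) (x1 + x2) (y1 + y2)"
    and B: "pair_point v (p 3) (p 6) y1 z1" "pair_point v (p 4) (p 7) y2 z2"
      "pair_point v (p 2) (p 5) (y1 + y2) (z1 + z2)"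
    and C: "pair_point w (p 2) (p 4) z1 x1" "pair_point w (p 3) (p 5) z2 x2"
      "pair_point w (p 6) (p 7) (z1 + z2) (x1 + x2)"
    using decomposition_normal_points[OF D] by (elim exE conjE)
  define g h f where "g = from_columns x1 x2" and "h = from_columns y1 y2" and "f = from_columns z1 z2"
  obtain g' where g: "g ** g' = mat 1" "g' ** g = mat 1" using from_columns_inverse[OF x] unfolding g_def .
  obtain h' where h: "h ** h' = mat 1" "h' ** h = mat 1" using from_columns_inverse[OF y] unfolding h_def .
  obtain f' where f: "f ** f' = mat 1" "f' ** f = mat 1" using from_columns_inverse[OF z] unfolding f_def .
  \<comment> \<open>Strassen's program moved so that its pair points become those found for
    \<open>T\<close>.\<close>
  define us vs ws where "us = (\<lambda>s. transpose g' ** ucoeff strassen s ** transpose h)"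
    and "vs = (\<lambda>s. transpose h' ** vcoeff strassen s ** transpose f)"
    and "ws = (\<lambda>s. transpose f' ** transpose (wcoeff strassen s) ** transpose g)"
  have Ds: "decomposition us vs ws"
    unfolding us_def vs_def ws_def by (rule decomposition_gauge[OF decomposition_strassen g(1) h(1) f(1)])
  have nz: "x1 \<noteq> 0" "x2 \<noteq> 0" "x1 + x2 \<noteq> 0" "y1 \<noteq> 0" "y2 \<noteq> 0" "y1 + y2 \<noteq> 0"
    "z1 \<noteq> 0" "z2 \<noteq> 0" "z1 + z2 \<noteq> 0"
    using A B C by (auto simp: pair_point_def)
  have As: "pair_point us 5 7 x1 y1" "pair_point us 2 6 x2 y2" "pair_point us 3 4 (x1 + x2) (y1 + y2)"
    using strassen_pair_points(1-3)[THEN pair_point_gauge[OF _ g(2) h_def y]] nz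
    unfolding us_def g_def h_def from_columns_mult by simp_all
  have Bs: "pair_point vs 3 6 y1 z1" "pair_point vs 4 7 y2 z2" "pair_point vs 2 5 (y1 + y2) (z1 + z2)"
    using strassen_pair_points(4-6)[THEN pair_point_gauge[OF _ h(2) f_def z]] nz
    unfolding vs_def h_def f_def from_columns_mult by simp_all
  have Cs: "pair_point ws 2 4 z1 x1" "pair_point ws 3 5 z2 x2" "pair_point ws 6 7 (z1 + z2) (x1 + x2)"
    using strassen_pair_points(7-9)[THEN pair_point_gauge[OF _ f(2) g_def x]] nz
    unfolding ws_def f_def g_def from_columns_mult by simp_all
  have p_range: "p s \<in> {1..7}" if "s \<in> {2..7}" for s
  proof -
    have "s = 2 \<or> s = 3 \<or> s = 4 \<or> s = 5 \<or> s = 6 \<or> s = 7" using that by auto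
    then show ?thesis
      using A[THEN pair_point_in_range] by (elim disjE) simp_all
  qed
  have card_p: "card (p ` {2..7}) = 6" using inj by (simp add: card_image)
  \<comment> \<open>The one index outside the configuration is matched with Strassen's first
    product.\<close>
  have "\<not> {1..7} \<subseteq> p ` {2..7}"
    using card_mono[of "p ` {2..7}" "{1..7::nat}"] card_p by auto
  then obtain r where r: "r \<in> {1..7}" "r \<notin> p ` {2..7}" by blast
  define \<pi> where "\<pi> = p(1 := r)"
  have \<pi>p: "\<pi> s = p s" if "s \<in> {2..7}" for s using that by (auto simp: \<pi>_def)
  have seven: "{1..7::nat} = insert 1 {2..7}" by auto
  have "inj_on \<pi> {2..7}" using inj inj_on_cong[of "{2..7}" \<pi> p, OF \<pi>p] by blast
  moreover have im: "\<pi> ` {2..7} = p ` {2..7}" by (rule image_cong[OF refl \<pi>p])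
  ultimately have \<pi>_inj: "inj_on \<pi> {1..7}" unfolding seven using r(2) by (simp add: \<pi>_def)
  have \<pi>_range: "\<pi> ` {1..7} \<subseteq> {1..7}"
    using im p_range r(1) by (auto simp: seven \<pi>_def)
  have \<pi>_bij: "bij_betw \<pi> {1..7} {1..7}"
    using \<pi>_inj \<pi>_range by (simp add: bij_betw_def endo_inj_surj)
  let ?t = "\<lambda>s A B C. pairing (u s) A * pairing (v s) B * pairing (w s) C"
  let ?ts = "\<lambda>s A B C. pairing (us s) A * pairing (vs s) B * pairing (ws s) C"
  have ne: "p i \<noteq> p j" if "i \<noteq> j" "2 \<le> i" "i \<le> 7" "2 \<le> j" "j \<le> 7" for i j
    using inj_onD[OF inj] that by auto
  note sA = A[THEN pair_point_swap] and sB = B[THEN pair_point_swap] and sC = C[THEN pair_point_swap]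
  note sAs = As[THEN pair_point_swap] and sBs = Bs[THEN pair_point_swap] and sCs = Cs[THEN pair_point_swap]
  \<comment> \<open>Each of the six labels lies on exactly one listed pair of each factor; swapping
    puts the common index first.\<close>
  have t2: "?t (p 2) A B C = ?ts 2 A B C" for A B C
    by (rule term_unique[OF D A(2) B(3) C(1) _ Ds As(2) Bs(3) Cs(1)]) (simp_all add: ne)
  have t3: "?t (p 3) A B C = ?ts 3 A B C" for A B C
    by (rule term_unique[OF D A(3) B(1) C(2) _ Ds As(3) Bs(1) Cs(2)]) (simp_all add: ne)
  have t4: "?t (p 4) A B C = ?ts 4 A B C" for A B C
    by (rule term_unique[OF D sA(3) B(2) sC(1) _ Ds sAs(3) Bs(2) sCs(1)]) (simp_all add: ne)
  have t5: "?t (p 5) A B C = ?ts 5 A B C" for A B C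
    by (rule term_unique[OF D A(1) sB(3) sC(2) _ Ds As(1) sBs(3) sCs(2)]) (simp_all add: ne)
  have t6: "?t (p 6) A B C = ?ts 6 A B C" for A B C
    by (rule term_unique[OF D sA(2) sB(1) C(3) _ Ds sAs(2) sBs(1) Cs(3)]) (simp_all add: ne)
  have t7: "?t (p 7) A B C = ?ts 7 A B C" for A B C
    by (rule term_unique[OF D sA(1) sB(2) sC(3) _ Ds sAs(1) sBs(2) sCs(3)]) (simp_all add: ne)
  have t_tail: "?t (\<pi> s) A B C = ?ts s A B C" if s: "s \<in> {2..7}" for s A B C
  proof -
    have "s = 2 \<or> s = 3 \<or> s = 4 \<or> s = 5 \<or> s = 6 \<or> s = 7" using s by auto
    then show ?thesis unfolding \<pi>p[OF s]
      by (elim disjE) (simp_all only: t2 t3 t4 t5 t6 t7)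
  qed
  \<comment> \<open>Both decompositions have the same total, and the other six terms agree.\<close>
  have t_one: "?t (\<pi> 1) A B C = ?ts 1 A B C" for A B C
  proof -
    have "(\<Sum>s\<in>{1..7}. ?t (\<pi> s) A B C) = (\<Sum>s\<in>{1..7}. ?t s A B C)"
      by (rule sum.reindex_bij_betw[OF \<pi>_bij])
    also have "\<dots> = (\<Sum>s\<in>{1..7}. ?ts s A B C)"
      using D Ds by (simp add: decomposition_def)
    finally have "?t (\<pi> 1) A B C + (\<Sum>s\<in>{2..7}. ?t (\<pi> s) A B C) = ?ts 1 A B C + (\<Sum>s\<in>{2..7}. ?ts s A B C)"
      unfolding seven by simp
    moreover have "(\<Sum>s\<in>{2..7}. ?t (\<pi> s) A B C) = (\<Sum>s\<in>{2..7}. ?ts s A B C)"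
      by (rule sum.cong) (simp_all only: t_tail)
    ultimately show ?thesis by simp
  qed
  have t_all: "?t (\<pi> s) A B C = ?ts s A B C" if "s \<in> {1..7}" for s A B C
    using that t_one t_tail unfolding seven by blast
  define \<rho> where "\<rho> = inv_into {1..7} \<pi>"
  have \<rho>\<pi>: "\<rho> (\<pi> s) = s" if "s \<in> {1..7}" for s
    unfolding \<rho>_def using \<pi>_inj that by (rule inv_into_f_f)
  have \<pi>\<rho>: "\<pi> (\<rho> r) = r" "\<rho> r \<in> {1..7}" if "r \<in> {1..7}" for r
    using \<pi>_bij that unfolding \<rho>_def bij_betw_def by (metis f_inv_into_f, metis inv_into_into)
  have t_rho: "?t r A B C = ?ts (\<rho> r) A B C" if "r \<in> {1..7}" for r A B C
    using t_all[OF \<pi>\<rho>(2)[OF that]] unfolding \<pi>\<rho>(1)[OF that] .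
  \<comment> \<open>In a shorter program \<open>u 7\<close> is the zero padding, so some term of
    Strassen's program would vanish identically.\<close>
  have len7: "len T = 7"
  proof (rule ccontr)
    assume "len T \<noteq> 7"
    with len have "u 7 = 0" by (simp add: u_def)
    then have 0: "?ts (\<rho> 7) A B C = 0" for A B C
      using t_rho[of 7 A B C] by (simp add: pairing_def)
    define s where "s = \<rho> 7"
    have s: "s \<in> {1..7}" unfolding s_def by (rule \<pi>\<rho>(2)) simp
    have cancel: "pairing (transpose P' ** U ** transpose Q) (P ** X ** Q') = pairing U X"
      if "P' ** P = mat 1" "Q' ** Q = mat 1" for P P' Q Q' U X :: "'a^2^2"
    proof -
      have "P' ** (P ** X ** Q') ** Q = (P' ** P) ** X ** (Q' ** Q)"
        by (simp only: matrix_mul_assoc)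
      then show ?thesis by (simp add: pairing_sandwich that)
    qed
    have "pairing (ucoeff strassen s) A * pairing (vcoeff strassen s) B
        * pairing (transpose (wcoeff strassen s)) C = 0" for A B C :: "'a^2^2"
      using 0[of "g ** A ** h'" "h ** B ** f'" "f ** C ** g'"]
      unfolding s_def[symmetric] us_def vs_def ws_def cancel[OF g(2) h(2)] cancel[OF h(2) f(2)]
        cancel[OF f(2) g(2)] .
    with strassen_term_nonzero[OF s, where 'a = 'a] show False by blast
  qed
  \<comment> \<open>The moved terms of Strassen, listed in the order of \<open>T\<close>. This
    triple has the summands of \<open>T\<close>, with the scalars distributed as the definition of
    equivalence demands.\<close>
  define T' where "T' = \<lparr>len = 7, ucoeff = (\<lambda>r. us (\<rho> r)), vcoeff = (\<lambda>r. vs (\<rho> r)),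
    wcoeff = (\<lambda>r. transpose (ws (\<rho> r)))\<rparr>"
  have T': "len T' = 7" "ucoeff T' r = us (\<rho> r)" "vcoeff T' r = vs (\<rho> r)"
    "wcoeff T' r = transpose (ws (\<rho> r))" for r
    by (simp_all add: T'_def)
  have same: "define_same_program T T'"
    unfolding define_same_program_def len7 T'(1)
  proof (intro conjI refl ballI allI)
    fix r A B l q assume r: "r \<in> {1..7::nat}"
    have u: "u r = ucoeff T r" using r by (simp add: u_def len7)
    show "summand T r A B l q = summand T' r A B l q"
      using t_rho[OF r, of A B "matrix_unit q l"]
        pairing_matrix_unit[of "wcoeff T r" q l] pairing_matrix_unit[of "wcoeff T' r" q l]
      by (simp add: summand_eq_pairing T' u v_def w_def mult_ac)
  qed
  have "elementary_program T'"
    using assms same by (auto simp: elementary_program_def define_same_program_def)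
  moreover have "elementary_program (strassen :: 'a triple)"
    by (rule elementary_program_of_decomposition[OF decomposition_strassen]) (simp add: strassen_def)
  moreover have "len T' = len (strassen :: 'a triple)" by (simp add: T' strassen_def)
  \<comment> \<open>The inverse substitution takes \<open>T'\<close> back to Strassen's triple; only
    the pair acting on left indices of \<open>u\<close> appears transposed.\<close>
  moreover have "inverse_pair (transpose g) (transpose g')"
    unfolding inverse_pair_def by (simp add: g matrix_transpose_mul[symmetric] transpose_mat)
  moreover have "inverse_pair h' h" "inverse_pair f' f"
    using h f by (simp_all add: inverse_pair_def)
  moreover have "\<forall>s\<in>{1..len T'}.
      (\<forall>i j. ucoeff strassen s $ i $ j = (\<Sum>\<nu>\<in>UNIV. \<Sum>\<kappa>\<in>UNIV.
        transpose g $ i $ \<nu> * h' $ j $ \<kappa> * ucoeff T' (\<pi> s) $ \<nu> $ \<kappa>)) \<and>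
      (\<forall>k l. vcoeff strassen s $ k $ l = (\<Sum>\<nu>\<in>UNIV. \<Sum>\<kappa>\<in>UNIV.
        h $ \<nu> $ k * f' $ l $ \<kappa> * vcoeff T' (\<pi> s) $ \<nu> $ \<kappa>)) \<and>
      (\<forall>l q. wcoeff strassen s $ l $ q = (\<Sum>\<nu>\<in>UNIV. \<Sum>\<kappa>\<in>UNIV.
        transpose g' $ \<nu> $ l * f $ \<kappa> $ q * wcoeff T' (\<pi> s) $ \<nu> $ \<kappa>))"
  proof (intro ballI conjI allI)
    fix s and i j :: 2 assume "s \<in> {1..len T'}"
    then have s: "\<rho> (\<pi> s) = s" by (simp add: T' \<rho>\<pi>)
    show "ucoeff strassen s $ i $ j = (\<Sum>\<nu>\<in>UNIV. \<Sum>\<kappa>\<in>UNIV.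
        transpose g $ i $ \<nu> * h' $ j $ \<kappa> * ucoeff T' (\<pi> s) $ \<nu> $ \<kappa>)"
      using double_sum_sandwich[of "transpose g" i "transpose h'" j "us s"]
      by (simp add: T' s us_def transpose_sandwich_cancel[OF g(2) h(2)] transpose_nth[of h'])
    show "vcoeff strassen s $ i $ j = (\<Sum>\<nu>\<in>UNIV. \<Sum>\<kappa>\<in>UNIV.
        h $ \<nu> $ i * f' $ j $ \<kappa> * vcoeff T' (\<pi> s) $ \<nu> $ \<kappa>)"
      using double_sum_sandwich[of "transpose h" i "transpose f'" j "vs s"]
      by (simp add: T' s vs_def transpose_sandwich_cancel[OF h(2) f(2)] transpose_nth[of h] transpose_nth[of f'])
    have "transpose (ws s) = g ** wcoeff strassen s ** f'"
      by (simp add: ws_def matrix_transpose_mul matrix_mul_assoc)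
    then have "g' ** transpose (ws s) ** f = (g' ** g) ** wcoeff strassen s ** (f' ** f)"
      by (simp only: matrix_mul_assoc)
    then show "wcoeff strassen s $ i $ j = (\<Sum>\<nu>\<in>UNIV. \<Sum>\<kappa>\<in>UNIV.
        transpose g' $ \<nu> $ i * f $ \<kappa> $ j * wcoeff T' (\<pi> s) $ \<nu> $ \<kappa>)"
      using double_sum_sandwich[of g' i f j "transpose (ws s)"]
      by (simp add: T' s g f transpose_nth[of g'])
  qed
  moreover have "\<pi> ` {1..len T'} \<subseteq> {1..len T'}" "inj_on \<pi> {1..len T'}"
    unfolding T'(1) by (rule \<pi>_range, rule \<pi>_inj)
  ultimately have "equivalent_triples T' strassen"
    unfolding equivalent_triples_def
    by - (intro conjI, assumption, assumption, assumption, rule exI[of _ "transpose g"],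
      rule exI[of _ "transpose g'"], rule exI[of _ h'], rule exI[of _ h], rule exI[of _ f'],
      rule exI[of _ f], rule exI[of _ \<pi>], intro conjI; assumption)
  with same show "\<exists>T'. define_same_program T T' \<and> equivalent_triples T' strassen" by blast
qed

end
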